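(* Let $\lambda$ and $\mu$ be partitions with $\ell(\lambda')\le n$. Then \[ g_{\lambda/\mu}(x) = \det \left(\sum_{k\ge0} \binom{\lambda_i'-\mu_j'-1}{k}\, e_{\lambda'_i-\mu'_j-i+j-k} (x_1,x_2,\dots) \right)_{1\le i,j\le n}, \] where $\binom{m}{k}$ is defined to be $\delta_{k,0}$ if $m<0$.
   Context: A partition $\lambda=(\lambda_1,\lambda_2,\dots)$ is a weakly decreasing sequence of positive integers (with $\lambda_i=0$ for $i>\ell(\lambda)$, where the length $\ell(\lambda)$ is the number of parts), identified with its Young diagram $\{(i,j): 1\le i\le \ell(\lambda),\ 1\le j\le\lambda_i\}$ ($i$ is the row index, $j$ the column index). The conjugate $\lambda'$ is the partition with diagram $\{(i,j):(j,i)\in\lambda\}$, and $\mu\subseteq\lambda$ means $\mu_i\le\lambda_i$ for all $i$; in that case $\lambda/\mu$ is the set difference of the diagrams. A reverse plane partition (RPP) of shape $\lambda/\mu$ is a map $R:\lambda/\mu\to\{1,2,\dots\}$ whose entries weakly increase along rows (left to right) and down columns. For variables $x=(x_1,x_2,\dots)$, the dual stable Grothendieck polynomial is $g_{\lambda/\mu}(x)=\sum_R\prod_{i\ge1}x_i^{a_i(R)}$, the sum over all RPPs $R$ of shape $\lambda/\mu$, where $a_i(R)$ is the number of columns of $R$ containing an $i$; it is $0$ by definition if $\mu\not\subseteq\lambda$. $e_k(x_1,x_2,\dots)=\sum_{i_1<i_2<\dots<i_k}x_{i_1}x_{i_2}\cdots x_{i_k}$ is the $k$th elementary symmetric function, with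 $e_0=1$ and $e_k=0$ for $k<0$. $\delta_{k,0}$ is $1$ if $k=0$ and $0$ otherwise.
   Formalization: The formal theorem also assumes ℓ(μ') ≤ n (automatic if μ ⊆ λ); without it the claim fails: for λ=(1), μ=(2), n=1, g_{λ/μ}=0 by definition but the determinant is e_0=1. *)

theory Defs
  imports
    "HOL-Library.Poly_Mapping"
    "HOL-Library.Groups_Big_Fun"
    "HOL-Library.FuncSet"
    "Jordan_Normal_Form.Determinant"
begin

section \<open>Formal power series in arbitrarily many variables\<close>

text \<open>
  A series assigns a coefficient to every monomial, where a monomial is a finitely supported
  exponent vector.
\<close>

typedef ('v, 'a) mfps = "UNIV :: (('v \<Rightarrow>\<^sub>0 nat) \<Rightarrow> 'a) set"
  morphisms mfps_coeff Abs_mfps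
  by simp

setup_lifting type_definition_mfps

lemma mfps_eqI: "(\<And>m. mfps_coeff f m = mfps_coeff g m) \<Longrightarrow> f = g"
  by (metis ext mfps_coeff_inject)

lemma finite_monomial_le:
  fixes m :: "'v \<Rightarrow>\<^sub>0 nat"
  shows "finite {a. \<exists>b. a + b = m}"
proof -
  let ?keys = "Poly_Mapping.keys :: ('v \<Rightarrow>\<^sub>0 nat) \<Rightarrow> _"
    and ?lookup = "Poly_Mapping.lookup :: ('v \<Rightarrow>\<^sub>0 nat) \<Rightarrow> _"
  let ?S = "{f :: 'v \<Rightarrow> nat. \<forall>x.
              (x \<in> ?keys m \<longrightarrow> f x \<in> {..Max (insert 0 (?lookup m ` ?keys m))})
              \<and> (x \<notin> ?keys m \<longrightarrow> f x = 0)}"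
  have "finite ?S"
    by (rule finite_set_of_finite_funs[OF Poly_Mapping.finite_keys finite_atMost])
  moreover have "?lookup ` {a. \<exists>b. a + b = m} \<subseteq> ?S"
  proof clarify
    fix a b :: "'v \<Rightarrow>\<^sub>0 nat" and x assume m: "m = a + b"
    have le: "?lookup a x \<le> ?lookup m x" by (simp add: m lookup_add)
    have "?lookup m x \<le> Max (insert 0 (?lookup m ` ?keys m))" if "x \<in> ?keys m"
      using that by (intro Max_ge) auto
    moreover have "?lookup m x = 0" if "x \<notin> ?keys m"
      using that by (simp add: in_keys_iff)
    ultimately show "(x \<in> ?keys (a + b)
          \<longrightarrow> ?lookup a x \<in> {..Max (insert 0 (?lookup (a + b) ` ?keys (a + b)))})
        \<and> (x \<notin> ?keys (a + b)
          \<longrightarrow> ?lookup a x = 0)"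
      using le m by (auto intro: order_trans)
  qed
  ultimately have "finite (?lookup ` {a. \<exists>b. a + b = m})"
    by (rule finite_subset[rotated])
  moreover have "inj_on ?lookup {a. \<exists>b. a + b = m}"
    by (auto intro: inj_onI simp: poly_mapping.lookup_inject)
  ultimately show ?thesis by (rule finite_imageD)
qed

lemma finite_monomial_splits:
  fixes m :: "'v \<Rightarrow>\<^sub>0 nat"
  shows "finite {(a, b). a + b = m}"
proof (rule finite_subset)
  show "{(a, b). a + b = m} \<subseteq> {a. \<exists>b. a + b = m} \<times> {a. \<exists>b. a + b = m}"
    by (auto intro: add.commute)
  show "finite ({a. \<exists>b. a + b = m} \<times> {a. \<exists>b. a + b = m})"
    by (simp add: finite_monomial_le)
qed

instantiation mfps :: (type, comm_ring_1) comm_ring_1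
begin

lift_definition zero_mfps :: "('a, 'b) mfps" is "\<lambda>_. 0" .
lift_definition one_mfps :: "('a, 'b) mfps" is "\<lambda>m. if m = 0 then 1 else 0" .
lift_definition plus_mfps :: "('a, 'b) mfps \<Rightarrow> ('a, 'b) mfps \<Rightarrow> ('a, 'b) mfps"
  is "\<lambda>f g m. f m + g m" .
lift_definition minus_mfps :: "('a, 'b) mfps \<Rightarrow> ('a, 'b) mfps \<Rightarrow> ('a, 'b) mfps"
  is "\<lambda>f g m. f m - g m" .
lift_definition uminus_mfps :: "('a, 'b) mfps \<Rightarrow> ('a, 'b) mfps"
  is "\<lambda>f m. - f m" .
lift_definition times_mfps :: "('a, 'b) mfps \<Rightarrow> ('a, 'b) mfps \<Rightarrow> ('a, 'b) mfps"
  is "\<lambda>f g m. \<Sum>(a, b) | a + b = m. f a * g b" .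

instance
proof
  fix f g h :: "('a, 'b) mfps"
  show "f * g * h = f * (g * h)"
  proof (rule mfps_eqI)
    fix m :: "'a \<Rightarrow>\<^sub>0 nat"
    let ?F = "mfps_coeff f" and ?G = "mfps_coeff g" and ?H = "mfps_coeff h"
    let ?L = "Sigma {(a, b). a + b = m} (\<lambda>(a, b). {(c, d). c + d = a})"
    let ?R = "Sigma {(a, b). a + b = m} (\<lambda>(a, b). {(c, d). c + d = b})"
    have "mfps_coeff (f * g * h) m
        = (\<Sum>p | fst p + snd p = m. \<Sum>q | fst q + snd q = fst p. ?F (fst q) * ?G (snd q) * ?H (snd p))"
      by (simp add: times_mfps.rep_eq case_prod_unfold sum_distrib_right)
    also have "\<dots> = (\<Sum>(p, q)\<in>?L. ?F (fst q) * ?G (snd q) * ?H (snd p))"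
      using finite_monomial_splits by (subst sum.Sigma) (auto simp: case_prod_unfold)
    also have "\<dots> = (\<Sum>(p, q)\<in>?R. ?F (fst p) * (?G (fst q) * ?H (snd q)))"
      by (rule sum.reindex_bij_witness[where
            i = "\<lambda>((a, b), (c, d)). ((a + c, d), (a, c))" and
            j = "\<lambda>((a, b), (c, d)). ((c, d + b), (d, b))"])
        (auto simp: algebra_simps)
    also have "\<dots> = (\<Sum>p | fst p + snd p = m. \<Sum>q | fst q + snd q = snd p. ?F (fst p) * (?G (fst q) * ?H (snd q)))"
      using finite_monomial_splits by (subst sum.Sigma) (auto simp: case_prod_unfold)
    also have "\<dots> = mfps_coeff (f * (g * h)) m"
      by (simp add: times_mfps.rep_eq case_prod_unfold sum_distrib_left)
    finally show "mfps_coeff (f * g * h) m = mfps_coeff (f * (g * h)) m" .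
  qed
  show "f * g = g * f"
  proof (rule mfps_eqI)
    fix m show "mfps_coeff (f * g) m = mfps_coeff (g * f) m"
      unfolding times_mfps.rep_eq
      by (rule sum.reindex_bij_witness[where i = prod.swap and j = prod.swap])
        (auto simp: ac_simps)
  qed
  show "1 * f = f"
  proof (rule mfps_eqI)
    fix m
    have "mfps_coeff (1 * f) m = (\<Sum>(a, b)\<in>{(0, m)}. mfps_coeff 1 a * mfps_coeff f b)"
      unfolding times_mfps.rep_eq
      by (rule sum.mono_neutral_right) (auto simp: finite_monomial_splits one_mfps.rep_eq split: if_splits)
    then show "mfps_coeff (1 * f) m = mfps_coeff f m"
      by (simp add: one_mfps.rep_eq)
  qed
  show "(f + g) * h = f * h + g * h"
    by (rule mfps_eqI)
      (simp add: times_mfps.rep_eq plus_mfps.rep_eq case_prod_unfold distrib_right sum.distrib)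
  show "(0 :: ('a, 'b) mfps) \<noteq> 1"
    by transfer (metis zero_neq_one)
qed (rule mfps_eqI;
     simp add: plus_mfps.rep_eq minus_mfps.rep_eq uminus_mfps.rep_eq zero_mfps.rep_eq algebra_simps)+

end

lift_definition mfps_var :: "'v \<Rightarrow> ('v, 'a :: comm_ring_1) mfps"
  is "\<lambda>v m. if m = Poly_Mapping.single v 1 then 1 else 0" .

text \<open>
  A formal sum over a possibly infinite index set, computed coefficientwise. It is meant for
  families in which every monomial occurs in only finitely many members.
\<close>

lift_definition mfps_sum :: "('b \<Rightarrow> ('v, 'a :: comm_ring_1) mfps) \<Rightarrow> 'b set \<Rightarrow> ('v, 'a) mfps"
  is "\<lambda>f A m. \<Sum>a | a \<in> A \<and> f a m \<noteq> 0. f a m" .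


section \<open>Partitions\<close>

definition is_partition :: "nat list \<Rightarrow> bool" where
  "is_partition p \<longleftrightarrow> sorted_wrt (\<ge>) p \<and> (\<forall>a \<in> set p. 0 < a)"

text \<open>The parts are numbered from 1; \<open>part p 0\<close> is a dummy value.\<close>

definition part :: "nat list \<Rightarrow> nat \<Rightarrow> nat" where
  "part p i = (if 1 \<le> i \<and> i \<le> length p then p ! (i - 1) else 0)"

definition diagram :: "nat list \<Rightarrow> (nat \<times> nat) set" where
  "diagram p = {(i, j). 1 \<le> i \<and> i \<le> length p \<and> 1 \<le> j \<and> j \<le> part p i}"

definition conj_partition :: "nat list \<Rightarrow> nat list" where
  "conj_partition p = (THE q. is_partition q \<and> diagram q = {(i, j). (j, i) \<in> diagram p})"

definition partition_le :: "nat list \<Rightarrow> nat list \<Rightarrow> bool" where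
  "partition_le m l \<longleftrightarrow> (\<forall>i. part m i \<le> part l i)"

definition skew_diagram :: "nat list \<Rightarrow> nat list \<Rightarrow> (nat \<times> nat) set" where
  "skew_diagram l m = diagram l - diagram m"

lemma part_antimono:
  assumes "is_partition p" "1 \<le> i" "i \<le> j"
  shows "part p j \<le> part p i"
proof (cases "j \<le> length p \<and> i < j")
  case True
  then show ?thesis
    using assms sorted_wrt_nth_less[of "(\<ge>)" p "i - 1" "j - 1"]
    by (auto simp: is_partition_def part_def)
next
  case False
  then show ?thesis using assms by (auto simp: part_def)
qed

lemma diagram_column:
  assumes "is_partition p" "1 \<le> i"
  shows "{j. (i, j) \<in> diagram p} = {1..part p i}"
  using assms by (auto simp: diagram_def part_def)

lemma diagram_eq_imp_eq:
  assumes "is_partition p" "is_partition q" "diagram p = diagram q"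
  shows "p = q"
proof -
  have part: "part p i = part q i" if "1 \<le> i" for i
    using diagram_column[OF assms(1) that] diagram_column[OF assms(2) that] assms(3)
    by (metis card_atLeastAtMost diff_Suc_1)
  have pos: "0 < part r i \<longleftrightarrow> i \<le> length r" if "is_partition r" "1 \<le> i" for r i
    using that by (auto simp: is_partition_def part_def)
  have "i \<le> length p \<longleftrightarrow> i \<le> length q" if "1 \<le> i" for i
    using that part[OF that] pos assms(1,2) by metis
  then have len: "length p = length q"
    by (metis le_antisym le_refl less_one linorder_not_less zero_le)
  show ?thesis
  proof (rule nth_equalityI[OF len])
    fix i assume "i < length p"
    then show "p ! i = q ! i" using part[of "Suc i"] len by (simp add: part_def)
  qed
qed

lemma conj_partition_exists:
  assumes "is_partition p"
  shows "\<exists>q. is_partition q \<and> diagram q = {(i, j). (j, i) \<in> diagram p}"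
proof -
  define C where "C j = {i. (i, j) \<in> diagram p}" for j
  define q where "q = map (\<lambda>j. card (C j)) [1..<Suc (part p 1)]"
  have fin: "finite (C j)" for j
    by (rule finite_subset[of _ "{..length p}"]) (auto simp: C_def diagram_def)
  have anti: "C j' \<subseteq> C j" if "1 \<le> j" "j \<le> j'" for j j'
    using that by (auto simp: C_def diagram_def)
  have down: "i' \<in> C j" if "i \<in> C j" "1 \<le> i'" "i' \<le> i" for i i' j
    using that part_antimono[OF assms, of i' i] by (auto simp: C_def diagram_def)
  have C: "C j = {1..card (C j)}" for j
  proof (cases "C j = {}")
    case False
    have "C j = {1..Max (C j)}"
    proof
      show "C j \<subseteq> {1..Max (C j)}"
        using fin by (auto simp: C_def diagram_def intro!: Max_ge)
      show "{1..Max (C j)} \<subseteq> C j"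
        using down[OF Max_in[OF fin False]] by auto
    qed
    then show ?thesis by (metis card_atLeastAtMost diff_Suc_1)
  qed auto
  have len: "length q = part p 1" by (simp add: q_def)
  have pq: "part q j = card (C j)" if "1 \<le> j" "j \<le> part p 1" for j
  proof -
    have "[1..<Suc (part p 1)] ! (j - 1) = 1 + (j - 1)"
      using that by (intro nth_upt) simp
    then have "q ! (j - 1) = card (C j)"
      using that unfolding q_def by (subst nth_map) (simp_all del: upt_Suc)
    then show ?thesis
      using that by (simp add: part_def[of q] len)
  qed
  have one: "1 \<in> C j" if "1 \<le> j" "j \<le> part p 1" for j
    using that by (auto simp: C_def diagram_def part_def split: if_splits)
  have "is_partition q"
    unfolding is_partition_def
  proof (intro conjI)
    show "sorted_wrt (\<ge>) q"
      by (auto simp: q_def sorted_wrt_iff_nth_less simp del: upt_Suc intro!: card_mono fin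
        intro: subsetD[OF anti, rotated 2])
    show "\<forall>a\<in>set q. 0 < a"
      using one fin by (force simp: q_def card_gt_0_iff simp del: upt_Suc)
  qed
  moreover have "(j, i) \<in> diagram q \<longleftrightarrow> (i, j) \<in> diagram p" for i j
  proof -
    have "(i, j) \<in> diagram p \<Longrightarrow> 1 \<le> j \<and> j \<le> part p 1"
      using part_antimono[OF assms, of 1 i] by (auto simp: diagram_def)
    then have "(i, j) \<in> diagram p \<longleftrightarrow> 1 \<le> j \<and> j \<le> part p 1 \<and> i \<in> C j"
      by (auto simp: C_def)
    also have "\<dots> \<longleftrightarrow> 1 \<le> j \<and> j \<le> part p 1 \<and> 1 \<le> i \<and> i \<le> card (C j)"
      using C[of j] by (metis atLeastAtMost_iff)
    also have "\<dots> \<longleftrightarrow> (j, i) \<in> diagram q"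
      using pq[of j] by (auto simp: diagram_def len)
    finally show ?thesis by simp
  qed
  ultimately show ?thesis by auto
qed

lemma conj_partition:
  assumes "is_partition p"
  shows is_partition_conj_partition: "is_partition (conj_partition p)"
    and diagram_conj_partition: "diagram (conj_partition p) = {(i, j). (j, i) \<in> diagram p}"
proof -
  have "\<exists>!q. is_partition q \<and> diagram q = {(i, j). (j, i) \<in> diagram p}"
    using conj_partition_exists[OF assms] diagram_eq_imp_eq by metis
  from theI'[OF this] show "is_partition (conj_partition p)"
    and "diagram (conj_partition p) = {(i, j). (j, i) \<in> diagram p}"
    by (simp_all add: conj_partition_def)
qed


section \<open>Dual stable Grothendieck polynomials\<close>

text \<open>
  Extensional function spaces make each filling of \<open>D\<close> a unique function, so that
  it is counted exactly once in the sum below.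
\<close>

definition rpps :: "(nat \<times> nat) set \<Rightarrow> (nat \<times> nat \<Rightarrow> nat) set" where
  "rpps D = {R \<in> D \<rightarrow>\<^sub>E {1..}.
     (\<forall>i j j'. (i, j) \<in> D \<and> (i, j') \<in> D \<and> j \<le> j' \<longrightarrow> R (i, j) \<le> R (i, j')) \<and>
     (\<forall>i i' j. (i, j) \<in> D \<and> (i', j) \<in> D \<and> i \<le> i' \<longrightarrow> R (i, j) \<le> R (i', j))}"

definition columns_containing :: "(nat \<times> nat) set \<Rightarrow> (nat \<times> nat \<Rightarrow> nat) \<Rightarrow> nat \<Rightarrow> nat" where
  "columns_containing D R a = card {j. \<exists>i. (i, j) \<in> D \<and> R (i, j) = a}"

text \<open>
  The variables are the \<open>mfps_var i\<close> with \<open>i \<ge> 1\<close>; \<open>mfps_var 0\<close> never occurs, because entries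
  of fillings are positive. For finite \<open>D\<close> only finitely many factors of the product differ from 1.
\<close>

definition rpp_monomial :: "(nat \<times> nat) set \<Rightarrow> (nat \<times> nat \<Rightarrow> nat) \<Rightarrow> (nat, int) mfps" where
  "rpp_monomial D R = Prod_any (\<lambda>i. mfps_var i ^ columns_containing D R i)"

definition dual_grothendieck :: "nat list \<Rightarrow> nat list \<Rightarrow> (nat, int) mfps" where
  "dual_grothendieck l m =
     (if partition_le m l
      then mfps_sum (rpp_monomial (skew_diagram l m)) (rpps (skew_diagram l m))
      else 0)"

text \<open>For \<open>k < 0\<close> the index set is empty and for \<open>k = 0\<close> it is \<open>{{}}\<close>, which gives 0 and 1.\<close>

definition esym :: "int \<Rightarrow> (nat, int) mfps" where
  "esym k = mfps_sum (\<lambda>S. \<Prod>i\<in>S. mfps_var i) {S. finite S \<and> S \<subseteq> {1..} \<and> int (card S) = k}"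

text \<open>Unlike the usual generalized binomial coefficient, this one is \<open>\<delta>\<^bsub>k,0\<^esub>\<close> for negative \<open>m\<close>.\<close>

definition binom :: "int \<Rightarrow> nat \<Rightarrow> nat" where
  "binom m k = (if m < 0 then (if k = 0 then 1 else 0) else nat m choose k)"

end

theory Submission
  imports Defs "HOL-Computational_Algebra.Formal_Power_Series"
begin

text \<open>
  Write \<open>a\<close> and \<open>b\<close> for the column lengths of \<open>\<lambda>\<close> and \<open>\<mu>\<close>, and number rows and columns of the
  matrix from 0. Put \<open>u = z / (1 + z)\<close> and \<open>H = \<Prod>\<^sub>v (1 + x\<^sub>v z)\<close>. For \<open>a\<^sub>r > b\<^sub>c\<close> the entry in row \<open>r\<close> and
  column \<open>c\<close> is the coefficient of \<open>z\<close> to the power \<open>a\<^sub>r - r + c\<close> in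
  \<open>(1 + z)\<^bsup>a\<^sub>r\<^esup> H u\<^bsup>b\<^sub>c\<^esup> / (1 + z)\<close>. Taking this formula for all \<open>r\<close> and \<open>c\<close> changes some entries with
  \<open>a\<^sub>r \<le> b\<^sub>c\<close>. They all lie above the diagonal, and a zero block below and to the left of them keeps
  every permutation of nonzero weight away from them (\<open>det_cong_off_zero_blocks\<close>,
  \<open>det_binom_entry\<close>). What is gained is that \<open>b\<^sub>c\<close> occurs only as an exponent of \<open>u\<close>.

  A new variable \<open>x\<close> multiplies \<open>H\<close> by \<open>1 + x z\<close>, and \<open>z = u + u\<^sup>2 + \<dots>\<close> gives
  \<open>(1 + x z) u\<^sup>b = u\<^sup>b + x \<Sum>\<^bsub>d > b\<^esub> u\<^sup>d\<close>. Expanding every column in this way writes the determinant as a sum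
  of determinants with fewer variables over all \<open>h \<ge> b\<close>, each weighted by \<open>x\<close> to the number of
  columns with \<open>h\<^sub>c > b\<^sub>c\<close>. The terms in which \<open>h\<close> is not weakly decreasing cancel: if \<open>k\<close> is the first
  ascent, summing over \<open>h\<^bsub>k+1\<^esub> > h\<^sub>k\<close> turns column \<open>k + 1\<close> into \<open>u\<^bsup>h\<^sub>k\<^esup>\<close> shifted by the factor \<open>z\<close>,
  which is column \<open>k\<close> (\<open>jt_det_first_ascent_cancel\<close>). The terms with \<open>h \<le> a\<close> false vanish because of a
  large zero block. So the sum runs over the partitions between \<open>\<mu>\<close> and \<open>\<lambda>\<close>
  (\<open>jt_det_add_variable\<close>).

  Reverse plane partitions satisfy the same recursion: the cells with the smallest allowed value
  form the part of the shape between \<open>b\<close> and some decreasing \<open>h\<close>, any such \<open>h\<close> can occur, and the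
  value is counted once in each column with \<open>h\<^sub>c > b\<^sub>c\<close> (\<open>rpp_gf_peel_smallest\<close>). With no variables left,
  both sides are 1 for equal shapes and 0 otherwise. This proves the formula in finitely many
  variables (\<open>jt_det_eq_rpp_gf\<close>). Setting all variables beyond the \<open>N\<close>th to zero is a ring
  homomorphism, and a series is determined by its images for all \<open>N\<close>, which gives the theorem for
  infinitely many variables.
\<close>

section \<open>Determinants and permutations\<close>

lemma det_mat_column_expansion:
  "det (mat n n (\<lambda>(r, c). f r c)) =
     (\<Sum>p | p permutes {0..<n}. signof p * (\<Prod>c<n. f (p c) c))"
proof -
  have "(\<Prod>c<n. mat n n (\<lambda>(r, c). f r c) $$ (p c, c)) = (\<Prod>c<n. f (p c) c)"
    if "p permutes {0..<n}" for p
    using permutes_in_image[OF that] by (intro prod.cong) auto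
  then show ?thesis
    by (subst det_col[of _ n]) (auto intro!: sum.cong)
qed

text \<open>
  Pigeonhole: \<open>p ` C\<close> is too large to fit into the complement of \<open>R\<close>.
\<close>
lemma permutation_hits_large_block:
  assumes p: "p permutes {0..<n}" and "C \<subseteq> {0..<n}" and "R \<subseteq> {0..<n}"
    and large: "n < card C + card R"
  obtains c where "c \<in> C" and "p c \<in> R"
proof -
  have "\<not> p ` C \<subseteq> {0..<n} - R"
  proof
    assume "p ` C \<subseteq> {0..<n} - R"
    then have "card (p ` C) \<le> card ({0..<n} - R)"
      by (intro card_mono) auto
    moreover have "card (p ` C) = card C"
      using permutes_inj_on[OF p] by (intro card_image) (auto intro: inj_on_subset)
    moreover have "card ({0..<n} - R) = n - card R"
      using assms(3) by (simp add: card_Diff_subset finite_subset)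
    ultimately show False
      using large card_mono[OF _ assms(2)] card_mono[OF _ assms(3)] by auto
  qed
  then show ?thesis
    using that assms(2) permutes_in_image[OF p] by blast
qed

lemma det_zero_block:
  fixes f :: "nat \<Rightarrow> nat \<Rightarrow> 'a :: comm_ring_1"
  assumes "C \<subseteq> {0..<n}" and "R \<subseteq> {0..<n}" and "n < card C + card R"
    and zero: "\<And>r c. r \<in> R \<Longrightarrow> c \<in> C \<Longrightarrow> f r c = 0"
  shows "det (mat n n (\<lambda>(r, c). f r c)) = 0"
proof -
  have "(\<Prod>c<n. f (p c) c) = 0" if p: "p permutes {0..<n}" for p
  proof -
    obtain c where "c \<in> C" "p c \<in> R"
      using permutation_hits_large_block[OF p assms(1-3)] .
    then show ?thesis
      using assms(1) by (intro prod_zero) (auto intro!: bexI[of _ c] zero)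
  qed
  then show ?thesis
    unfolding det_mat_column_expansion by simp
qed

text \<open>
  An entry \<open>(r, c)\<close> above the diagonal is irrelevant if all entries below row \<open>r\<close> in columns \<open>0..r\<close>
  vanish: these \<open>r + 1\<close> columns must then be matched with the rows \<open>0..r\<close>, so that row \<open>r\<close> is never
  matched with \<open>c\<close>.
\<close>
lemma det_cong_off_zero_blocks:
  fixes f g :: "nat \<Rightarrow> nat \<Rightarrow> 'a :: comm_ring_1"
  assumes "\<And>r c. r < n \<Longrightarrow> c < n \<Longrightarrow> f r c = g r c \<or>
      (r < c \<and> (\<forall>r' c'. r < r' \<longrightarrow> r' < n \<longrightarrow> c' \<le> r \<longrightarrow> f r' c' = 0 \<and> g r' c' = 0))"
  shows "det (mat n n (\<lambda>(r, c). f r c)) = det (mat n n (\<lambda>(r, c). g r c))"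
proof -
  have "(\<Prod>c<n. f (p c) c) = (\<Prod>c<n. g (p c) c)" if p: "p permutes {0..<n}" for p
  proof (cases "\<forall>c<n. f (p c) c = g (p c) c")
    case False
    then obtain c where c: "c < n" and ne: "f (p c) c \<noteq> g (p c) c"
      by auto
    define r where "r = p c"
    have r: "r < n"
      using c permutes_in_image[OF p] by (auto simp: r_def)
    have rc: "r < c"
      and z: "\<And>r' c'. r < r' \<Longrightarrow> r' < n \<Longrightarrow> c' \<le> r \<Longrightarrow> f r' c' = 0 \<and> g r' c' = 0"
      using assms[OF r c] ne by (auto simp: r_def)
    (* The r + 1 columns 0..r cannot all be sent to rows above row r, and row r is taken by c. *)
    obtain c' where c': "c' \<in> {0..r}" "p c' \<in> {r..<n}"
      by (rule permutation_hits_large_block[OF p, of "{0..r}" "{r..<n}"]) (use r in auto)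
    have "p c' \<noteq> r"
      using c' rc inj_onD[OF permutes_inj_on[OF p], of c' c UNIV] by (auto simp: r_def)
    then have "f (p c') c' = 0 \<and> g (p c') c' = 0"
      using c' by (intro z) auto
    moreover have "c' < n"
      using c' r by auto
    ultimately have "(\<Prod>c<n. f (p c) c) = 0" and "(\<Prod>c<n. g (p c) c) = 0"
      by (auto intro!: prod_zero bexI[of _ c'])
    then show ?thesis
      by simp
  qed (auto intro: prod.cong)
  then show ?thesis
    unfolding det_mat_column_expansion by (auto intro!: sum.cong)
qed

lemma det_sum_all_columns:
  fixes v :: "nat \<Rightarrow> 'b \<Rightarrow> nat \<Rightarrow> 'a :: comm_ring_1"
  assumes fin: "\<And>c. c < n \<Longrightarrow> finite (S c)"
  shows "det (mat n n (\<lambda>(r, c). \<Sum>d\<in>S c. w c d * v r d c)) =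
    (\<Sum>h\<in>PiE {..<n} S. (\<Prod>c<n. w c (h c)) * det (mat n n (\<lambda>(r, c). v r (h c) c)))"
proof -
  let ?P = "{p. p permutes {0..<n}}"
  have "det (mat n n (\<lambda>(r, c). \<Sum>d\<in>S c. w c d * v r d c)) =
      (\<Sum>p\<in>?P. signof p * (\<Sum>h\<in>PiE {..<n} S. \<Prod>c<n. w c (h c) * v (p c) (h c) c))"
    unfolding det_mat_column_expansion using fin by (subst prod_sum_PiE) auto
  also have "\<dots> = (\<Sum>h\<in>PiE {..<n} S. \<Sum>p\<in>?P. signof p * (\<Prod>c<n. w c (h c) * v (p c) (h c) c))"
    by (simp add: sum_distrib_left) (rule sum.swap)
  also have "\<dots> = (\<Sum>h\<in>PiE {..<n} S. (\<Prod>c<n. w c (h c)) * det (mat n n (\<lambda>(r, c). v r (h c) c)))"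
    unfolding det_mat_column_expansion by (simp add: sum_distrib_left prod.distrib mult_ac)
  finally show ?thesis .
qed

lemma det_sum_one_column:
  fixes v :: "nat \<Rightarrow> 'b \<Rightarrow> 'a :: comm_ring_1"
  assumes "k < n"
  shows "(\<Sum>d\<in>S. det (mat n n (\<lambda>(r, c). if c = k then v r d else f r c))) =
    det (mat n n (\<lambda>(r, c). if c = k then (\<Sum>d\<in>S. v r d) else f r c))"
proof -
  have split: "(\<Prod>c<n. if c = k then g c else f (p c) c) = g k * (\<Prod>c\<in>{..<n}-{k}. f (p c) c)"
    for g :: "nat \<Rightarrow> 'a" and p
    using assms by (subst prod.remove[of _ k]) (auto intro!: prod.cong)
  show ?thesis
    unfolding det_mat_column_expansion split
    by (subst sum.swap) (simp add: sum_distrib_left sum_distrib_right mult_ac)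
qed

lemma det_equal_columns:
  fixes f :: "nat \<Rightarrow> nat \<Rightarrow> 'a :: comm_ring_1"
  assumes "k < n" and "l < n" and "k \<noteq> l" and "\<And>r. r < n \<Longrightarrow> f r k = f r l"
  shows "det (mat n n (\<lambda>(r, c). f r c)) = 0"
  using assms by (intro det_identical_columns[of _ n k l]) auto

section \<open>Generating functions for the matrix entries\<close>

text \<open>
  The series \<open>1 / (1 + z)\<close>, written out because the coefficient ring has no division.
\<close>
definition geom :: "'a :: comm_ring_1 fps" where
  "geom = Abs_fps (\<lambda>k. (-1) ^ k)"

lemma geom_inverse: "(1 + fps_X) * geom = 1"
proof (rule fps_ext)
  fix k
  show "fps_nth ((1 + fps_X) * geom) k = fps_nth (1 :: 'a fps) k"
    by (cases k) (simp_all add: geom_def distrib_right)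
qed

lemma geom_eq: "geom = 1 - fps_X * geom"
  using geom_inverse by (simp add: distrib_right eq_diff_eq add.commute)

text \<open>
  The coefficient of \<open>z\<close> to the power \<open>a - r + c\<close> in \<open>(1 + z)\<^sup>a H u\<^sup>b / (1 + z)\<close> with \<open>u = z / (1 + z)\<close>. The factor
  \<open>z\<^sup>r\<close> keeps the index \<open>a + c\<close> natural when \<open>a + c < r\<close>.
\<close>
definition jt_entry :: "'a :: comm_ring_1 fps \<Rightarrow> nat \<Rightarrow> nat \<Rightarrow> nat \<Rightarrow> nat \<Rightarrow> 'a" where
  "jt_entry H a r b c =
     fps_nth (fps_X ^ r * (1 + fps_X) ^ a * H * ((fps_X * geom) ^ b * geom)) (a + c)"

lemma jt_entry_shift:
  "jt_entry H a r b c =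
     (if a + c < r + b then 0
      else fps_nth ((1 + fps_X) ^ a * geom ^ Suc b * H) (a + c - (r + b)))"
proof -
  have "fps_X ^ r * (1 + fps_X) ^ a * H * ((fps_X * geom) ^ b * geom) =
      fps_X ^ (r + b) * ((1 + fps_X) ^ a * geom ^ Suc b * H)"
    by (simp add: power_add power_mult_distrib mult_ac)
  then show ?thesis
    unfolding jt_entry_def by (simp add: fps_X_power_mult_nth)
qed

lemma jt_entry_eq_0: "a + c < r + b \<Longrightarrow> jt_entry H a r b c = 0"
  by (simp add: jt_entry_shift)

text \<open>
  This is \<open>z = u + u\<^sup>2 + \<dots>\<close> multiplied by \<open>u\<^sup>b / (1 + z)\<close> and cut off at \<open>K\<close>. The remainder is a multiple of
  \<open>z\<^bsup>K+1\<^esup>\<close>, so it does not affect low coefficients.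
\<close>
lemma X_mult_column_gf:
  assumes "b \<le> K"
  shows "fps_X * ((fps_X * geom) ^ b * geom) =
    (\<Sum>d\<in>{b<..K}. (fps_X * geom) ^ d * geom) + fps_X * ((fps_X * geom) ^ K * (geom :: 'a :: comm_ring_1 fps))"
  using assms
proof (induction K rule: dec_induct)
  case (step K)
  have "fps_X * ((fps_X * geom) ^ K * (geom :: 'a fps)) = (fps_X * geom) ^ Suc K"
    by (simp add: mult_ac)
  also have "\<dots> = (fps_X * geom) ^ Suc K * geom + fps_X * ((fps_X * geom) ^ Suc K * geom)"
    by (subst (2) geom_eq) (simp add: algebra_simps)
  finally have *: "fps_X * ((fps_X * geom) ^ K * (geom :: 'a fps)) = \<dots>" .
  have "{b<..Suc K} = insert (Suc K) {b<..K}"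
    using step by auto
  then show ?case
    using step.IH unfolding * by (simp add: add_ac)
qed simp

lemma X_jt_entry_tail:
  assumes "a + c \<le> r + K"
  shows "fps_nth (fps_X ^ r * (1 + fps_X) ^ a * H * (fps_X * ((fps_X * geom) ^ K * geom))) (a + c) = 0"
proof -
  have "fps_X ^ r * (1 + fps_X) ^ a * H * (fps_X * ((fps_X * geom) ^ K * geom)) =
      fps_X ^ Suc (r + K) * ((1 + fps_X) ^ a * geom ^ Suc K * H)"
    by (simp add: power_add power_mult_distrib mult_ac)
  then show ?thesis
    using assms by (simp only: fps_X_power_mult_nth) simp
qed

text \<open>
  Moving one column to the right multiplies the series by \<open>1 / z\<close>, and \<open>u\<^sup>b = (\<Sum>\<^bsub>d > b\<^esub> u\<^sup>d) / z\<close>. Hence the sum of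
  column \<open>c + 1\<close> over all \<open>d > b\<close> is column \<open>c\<close> at \<open>b\<close>; this makes two columns of the determinant
  equal in the cancellation below.
\<close>
lemma jt_entry_telescope:
  assumes "b \<le> K" and "a + Suc c \<le> r + K"
  shows "(\<Sum>d\<in>{b<..K}. jt_entry H a r d (Suc c)) = jt_entry H a r b c"
proof -
  let ?P = "fps_X ^ r * (1 + fps_X) ^ a * H" and ?V = "\<lambda>d. (fps_X * geom) ^ d * geom"
  have "jt_entry H a r b c = fps_nth (fps_X * (?P * ?V b)) (a + Suc c)"
    by (simp add: jt_entry_def)
  also have "fps_X * (?P * ?V b) = ?P * (fps_X * ?V b)"
    by (simp add: mult_ac)
  also have "\<dots> = (\<Sum>d\<in>{b<..K}. ?P * ?V d) + ?P * (fps_X * ?V K)"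
    unfolding X_mult_column_gf[OF assms(1)] by (simp only: distrib_left sum_distrib_left)
  finally show ?thesis
    using X_jt_entry_tail[OF assms(2), of H] by (simp add: fps_sum_nth jt_entry_def)
qed

text \<open>
  The identity \<open>(1 + x z) u\<^sup>b = u\<^sup>b + x \<Sum>\<^bsub>d > b\<^esub> u\<^sup>d\<close>; the terms with \<open>d > K\<close> have no coefficient in the
  relevant degree.
\<close>
lemma jt_entry_add_variable:
  assumes "a + c \<le> r + K"
  shows "jt_entry ((1 + fps_const x * fps_X) * H) a r b c =
    (\<Sum>d\<in>{b..K}. (if b < d then x else 1) * jt_entry H a r d c)"
proof (cases "b \<le> K")
  case True
  let ?P = "fps_X ^ r * (1 + fps_X) ^ a * H" and ?V = "\<lambda>d. (fps_X * geom) ^ d * geom"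
  have "fps_X ^ r * (1 + fps_X) ^ a * ((1 + fps_const x * fps_X) * H) * ?V b =
      ?P * ?V b + fps_const x * (?P * (fps_X * ?V b))"
    by (simp add: algebra_simps)
  also have "\<dots> = ?P * ?V b + fps_const x * ((\<Sum>d\<in>{b<..K}. ?P * ?V d) + ?P * (fps_X * ?V K))"
    unfolding X_mult_column_gf[OF True] by (simp only: distrib_left sum_distrib_left)
  finally have "jt_entry ((1 + fps_const x * fps_X) * H) a r b c =
      jt_entry H a r b c + x * (\<Sum>d\<in>{b<..K}. jt_entry H a r d c)"
    using X_jt_entry_tail[OF assms, of H] by (simp add: fps_sum_nth jt_entry_def)
  also have "{b..K} = insert b {b<..K}"
    using True by auto
  ultimately show ?thesis
    by (simp add: sum_distrib_left)
next
  case False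
  then show ?thesis
    using assms by (simp add: jt_entry_eq_0)
qed

section \<open>Adding a variable to the determinant\<close>

definition jt_det :: "nat \<Rightarrow> 'a :: comm_ring_1 fps \<Rightarrow> (nat \<Rightarrow> nat) \<Rightarrow> (nat \<Rightarrow> nat) \<Rightarrow> 'a" where
  "jt_det n H a b = det (mat n n (\<lambda>(r, c). jt_entry H (a r) r (b c) c))"

lemma jt_det_add_variable_unrestricted:
  assumes K: "\<And>r. r < n \<Longrightarrow> a r + n \<le> K"
  shows "jt_det n ((1 + fps_const x * fps_X) * H) a b =
    (\<Sum>h\<in>PiE {..<n} (\<lambda>c. {b c..K}). (\<Prod>c<n. if b c < h c then x else 1) * jt_det n H a h)"
proof -
  have "jt_entry ((1 + fps_const x * fps_X) * H) (a r) r (b c) c =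
      (\<Sum>d\<in>{b c..K}. (if b c < d then x else 1) * jt_entry H (a r) r d c)"
    if "r < n" "c < n" for r c
    using K[OF that(1)] that by (intro jt_entry_add_variable) simp
  then have "mat n n (\<lambda>(r, c). jt_entry ((1 + fps_const x * fps_X) * H) (a r) r (b c) c) =
      mat n n (\<lambda>(r, c). \<Sum>d\<in>{b c..K}. (if b c < d then x else 1) * jt_entry H (a r) r d c)"
    by (intro cong_mat) auto
  then show ?thesis
    unfolding jt_det_def
    by (simp only:) (rule det_sum_all_columns[where v = "\<lambda>r d c. jt_entry H (a r) r d c"
        and w = "\<lambda>c d. if b c < d then x else 1"], simp)
qed

text \<open>
  The set is the union of lines in direction \<open>h (Suc k)\<close>. On a line, \<open>b (Suc k) \<le> b k \<le> h k < h (Suc k)\<close> keeps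
  the weight constant, and only column \<open>Suc k\<close> of the determinant varies. Its sum over the line is
  column \<open>k\<close> by \<open>jt_entry_telescope\<close>.
\<close>
lemma jt_det_first_ascent_cancel:
  fixes a b :: "nat \<Rightarrow> nat"
  assumes K: "\<And>r. r < n \<Longrightarrow> a r + n \<le> K" and b: "antimono_on {..<n} b" and k: "Suc k < n"
  defines "B \<equiv> {h \<in> PiE {..<n} (\<lambda>c. {b c..K}). h k < h (Suc k) \<and> (\<forall>i<k. h (Suc i) \<le> h i)}"
  shows "(\<Sum>h\<in>B. (\<Prod>c<n. if b c < h c then x else 1) * jt_det n H a h) = 0"
proof -
  let ?F = "\<lambda>h. (\<Prod>c<n. if b c < h c then x else 1) * jt_det n H a h"
  let ?g = "\<lambda>h :: nat \<Rightarrow> nat. h(Suc k := 0)"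
  have finB: "finite B"
    unfolding B_def by (rule finite_subset[of _ "PiE {..<n} (\<lambda>c. {b c..K})"]) (auto intro: finite_PiE)
  have fiber: "(\<Sum>h\<in>{h \<in> B. ?g h = ?g h0}. ?F h) = 0" if h0: "h0 \<in> B" for h0
  proof -
    have h0K: "h0 \<in> PiE {..<n} (\<lambda>c. {b c..K})" and asc: "h0 k < h0 (Suc k)"
      and desc: "\<And>i. i < k \<Longrightarrow> h0 (Suc i) \<le> h0 i"
      using h0 by (auto simp: B_def)
    have bk: "b (Suc k) \<le> h0 k"
    proof -
      have "b (Suc k) \<le> b k"
        using b k by (auto simp: monotone_on_def)
      also have "b k \<le> h0 k"
        using PiE_mem[OF h0K, of k] k by simp
      finally show ?thesis .
    qed
    have eq: "{h \<in> B. ?g h = ?g h0} = (\<lambda>d. h0(Suc k := d)) ` {h0 k<..K}"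
    proof (intro equalityI subsetI)
      fix h assume h: "h \<in> {h \<in> B. ?g h = ?g h0}"
      then have "?g h = ?g h0"
        by simp
      then have same: "h i = h0 i" if "i \<noteq> Suc k" for i
        using that by (metis fun_upd_other)
      have "h (Suc k) \<in> {h0 k<..K}"
        using h k same[of k] PiE_mem[of h "{..<n}" "\<lambda>c. {b c..K}" "Suc k"] by (auto simp: B_def)
      moreover have "h = h0(Suc k := h (Suc k))"
        using same by auto
      ultimately show "h \<in> (\<lambda>d. h0(Suc k := d)) ` {h0 k<..K}"
        by blast
    next
      fix h assume "h \<in> (\<lambda>d. h0(Suc k := d)) ` {h0 k<..K}"
      then obtain d where d: "h = h0(Suc k := d)" "h0 k < d" "d \<le> K"
        by auto
      have "h \<in> PiE {..<n} (\<lambda>c. {b c..K})"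
        using h0K d bk k by (auto simp: PiE_def extensional_def)
      then show "h \<in> {h \<in> B. ?g h = ?g h0}"
        using d desc by (auto simp: B_def)
    qed
    have F: "?F (h0(Suc k := d)) = (\<Prod>c<n. if b c < h0 c then x else 1) *
        det (mat n n (\<lambda>(r, c). if c = Suc k then jt_entry H (a r) r d (Suc k)
           else jt_entry H (a r) r (h0 c) c))" if "d \<in> {h0 k<..K}" for d
    proof -
      have "(\<Prod>c<n. if b c < (h0(Suc k := d)) c then x else 1) = (\<Prod>c<n. if b c < h0 c then x else 1)"
        using that bk asc by (intro prod.cong) auto
      moreover have "mat n n (\<lambda>(r, c). jt_entry H (a r) r ((h0(Suc k := d)) c) c) =
          mat n n (\<lambda>(r, c). if c = Suc k then jt_entry H (a r) r d (Suc k)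
            else jt_entry H (a r) r (h0 c) c)"
        by (intro cong_mat) auto
      ultimately show ?thesis
        unfolding jt_det_def by (simp only:)
    qed
    have tele: "(\<Sum>d\<in>{h0 k<..K}. jt_entry H (a r) r d (Suc k)) = jt_entry H (a r) r (h0 k) k"
      if "r < n" for r
    proof (rule jt_entry_telescope)
      show "h0 k \<le> K"
        using PiE_mem[OF h0K, of k] k by simp
      show "a r + Suc k \<le> r + K"
        using K[OF that] k by simp
    qed
    have "(\<Sum>h\<in>{h \<in> B. ?g h = ?g h0}. ?F h) = (\<Sum>d\<in>{h0 k<..K}. ?F (h0(Suc k := d)))"
      unfolding eq by (subst sum.reindex) (auto intro!: inj_onI dest: fun_cong[of _ _ "Suc k"])
    also have "\<dots> = (\<Prod>c<n. if b c < h0 c then x else 1) *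
        (\<Sum>d\<in>{h0 k<..K}. det (mat n n (\<lambda>(r, c). if c = Suc k then jt_entry H (a r) r d (Suc k)
           else jt_entry H (a r) r (h0 c) c)))"
      by (simp only: F sum_distrib_left cong: sum.cong)
    also have "(\<Sum>d\<in>{h0 k<..K}. det (mat n n (\<lambda>(r, c). if c = Suc k
           then jt_entry H (a r) r d (Suc k) else jt_entry H (a r) r (h0 c) c))) = 0"
      using k tele by (subst det_sum_one_column) (auto intro!: det_equal_columns[of k _ "Suc k"])
    finally show ?thesis
      by (simp only: mult_zero_right)
  qed
  have "(\<Sum>h\<in>B. ?F h) = (\<Sum>y\<in>?g ` B. \<Sum>h\<in>{h \<in> B. ?g h = y}. ?F h)"
    using finB by (subst sum.group) auto
  also have "\<dots> = 0"
    using fiber by (intro sum.neutral) blast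
  finally show ?thesis .
qed

lemma not_antimono_first_ascent:
  fixes h :: "nat \<Rightarrow> nat"
  shows "\<not> antimono_on {..<n} h \<longleftrightarrow> (\<exists>k. Suc k < n \<and> h k < h (Suc k) \<and> (\<forall>i<k. h (Suc i) \<le> h i))"
proof
  assume "\<not> antimono_on {..<n} h"
  have "\<exists>k. Suc k < n \<and> h k < h (Suc k)"
  proof (rule ccontr)
    assume "\<not> ?thesis"
    then have step: "h (Suc i) \<le> h i" if "Suc i < n" for i
      using that by (meson not_le)
    have "h j \<le> h i" if "i \<le> j" "j < n" for i j
      using that by (induction j rule: dec_induct) (auto intro: order_trans step)
    with \<open>\<not> antimono_on {..<n} h\<close> show False
      by (auto simp: monotone_on_def)
  qed
  then obtain k where k: "Suc k < n \<and> h k < h (Suc k)"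
    and least: "\<And>i. i < k \<Longrightarrow> \<not> (Suc i < n \<and> h i < h (Suc i))"
    using exists_least_iff[of "\<lambda>k. Suc k < n \<and> h k < h (Suc k)"] by blast
  have "h (Suc i) \<le> h i" if "i < k" for i
    using least[OF that] that k by auto
  with k show "\<exists>k. Suc k < n \<and> h k < h (Suc k) \<and> (\<forall>i<k. h (Suc i) \<le> h i)"
    by blast
next
  assume "\<exists>k. Suc k < n \<and> h k < h (Suc k) \<and> (\<forall>i<k. h (Suc i) \<le> h i)"
  then obtain k where "Suc k < n" "h k < h (Suc k)"
    by blast
  then show "\<not> antimono_on {..<n} h"
    using monotone_onD[of "{..<n}" "(\<le>)" "(\<ge>)" h k "Suc k"] by auto
qed

text \<open>
  Below and to the left of \<open>(j, j)\<close>, inclusively, all entries are coefficients in negative degree.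
\<close>
lemma jt_det_not_contained:
  assumes "antimono_on {..<n} a" and "antimono_on {..<n} b" and "j < n" and "a j < b j"
  shows "jt_det n H a b = 0"
  unfolding jt_det_def
proof (rule det_zero_block[where C = "{0..j}" and R = "{j..<n}"])
  fix r c assume "r \<in> {j..<n}" "c \<in> {0..j}"
  then have "a r \<le> a j" and "b j \<le> b c" and "c \<le> r"
    using assms(1-3) by (auto simp: monotone_on_def)
  then show "jt_entry H (a r) r (b c) c = 0"
    using assms(4) by (intro jt_entry_eq_0) simp
qed (use assms in auto)

text \<open>
  Grouping the other \<open>h\<close> by their first ascent makes them cancel, and those not below \<open>a\<close> contribute
  zero determinants.
\<close>
lemma jt_det_add_variable:
  fixes a b :: "nat \<Rightarrow> nat"
  assumes a: "antimono_on {..<n} a" and b: "antimono_on {..<n} b"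
  shows "jt_det n ((1 + fps_const x * fps_X) * H) a b =
    (\<Sum>h\<in>{h \<in> PiE {..<n} (\<lambda>c. {b c..a c}). antimono_on {..<n} h}.
       (\<Prod>c<n. if b c < h c then x else 1) * jt_det n H a h)"
proof -
  let ?F = "\<lambda>h. (\<Prod>c<n. if b c < h c then x else 1) * jt_det n H a h"
  define K where "K = a 0 + n"
  have aK: "a r + n \<le> K" if "r < n" for r
    using a that by (auto simp: K_def monotone_on_def)
  define S where "S = PiE {..<n} (\<lambda>c. {b c..K})"
  define B where "B k = {h \<in> S. h k < h (Suc k) \<and> (\<forall>i<k. h (Suc i) \<le> h i)}" for k
  have finS: "finite S"
    unfolding S_def by (intro finite_PiE) auto
  have "{h \<in> S. \<not> antimono_on {..<n} h} = (\<Union>k\<in>{k. Suc k < n}. B k)"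
    unfolding not_antimono_first_ascent by (auto simp: B_def)
  moreover have "sum ?F (\<Union>k\<in>{k. Suc k < n}. B k) = (\<Sum>k\<in>{k. Suc k < n}. sum ?F (B k))"
  proof (rule sum.UNION_disjoint)
    show "finite {k. Suc k < n}"
      by (rule finite_subset[of _ "{..<n}"]) auto
    show "\<forall>k\<in>{k. Suc k < n}. finite (B k)"
      using finS by (simp add: B_def)
    have "B k \<inter> B l = {}" if "k < l" for k l
      using that by (auto simp: B_def not_le[symmetric])
    then show "\<forall>k\<in>{k. Suc k < n}. \<forall>l\<in>{k. Suc k < n}. k \<noteq> l \<longrightarrow> B k \<inter> B l = {}"
      by (metis Int_commute linorder_neqE_nat)
  qed
  moreover have "sum ?F (B k) = 0" if "Suc k < n" for k
    unfolding B_def S_def by (rule jt_det_first_ascent_cancel[OF aK b that])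
  ultimately have bad: "sum ?F {h \<in> S. \<not> antimono_on {..<n} h} = 0"
    by simp
  have "jt_det n ((1 + fps_const x * fps_X) * H) a b = sum ?F S"
    unfolding S_def by (rule jt_det_add_variable_unrestricted[OF aK])
  also have "\<dots> = sum ?F {h \<in> S. antimono_on {..<n} h} + sum ?F {h \<in> S. \<not> antimono_on {..<n} h}"
    using finS by (subst sum.union_disjoint[symmetric]) (auto intro: arg_cong[of _ _ "sum ?F"])
  also have "\<dots> = sum ?F {h \<in> S. antimono_on {..<n} h}"
    using bad by simp
  also have "\<dots> = sum ?F {h \<in> PiE {..<n} (\<lambda>c. {b c..a c}). antimono_on {..<n} h}"
  proof (rule sum.mono_neutral_right)
    show "{h \<in> PiE {..<n} (\<lambda>c. {b c..a c}). antimono_on {..<n} h} \<subseteq> {h \<in> S. antimono_on {..<n} h}"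
      using aK by (fastforce simp: S_def PiE_def Pi_def)
    show "\<forall>h\<in>{h \<in> S. antimono_on {..<n} h} - {h \<in> PiE {..<n} (\<lambda>c. {b c..a c}). antimono_on {..<n} h}.
        ?F h = 0"
    proof
      fix h assume h: "h \<in> {h \<in> S. antimono_on {..<n} h} -
          {h \<in> PiE {..<n} (\<lambda>c. {b c..a c}). antimono_on {..<n} h}"
      then obtain j where "j < n" "a j < h j"
        by (auto simp: S_def PiE_def Pi_def not_le)
      then show "?F h = 0"
        using h jt_det_not_contained[OF a, of h j H] by auto
    qed
  qed (use finS in simp)
  finally show ?thesis .
qed

lemma one_plus_X_power_nth:
  "fps_nth ((1 + fps_X) ^ p :: 'a :: comm_ring_1 fps) k = of_nat (p choose k)"
proof (induction p arbitrary: k)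
  case 0
  then show ?case
    by (cases k) auto
next
  case (Suc p)
  then show ?case
    by (cases k) (simp_all add: distrib_right add.commute)
qed

lemma one_plus_X_power_geom:
  "(1 + fps_X) ^ (p + q) * geom ^ q = (1 + fps_X :: 'a :: comm_ring_1 fps) ^ p"
  by (simp add: power_add mult.assoc power_mult_distrib[symmetric] geom_inverse)

lemma jt_entry_above:
  assumes "b < a"
  shows "jt_entry (H :: 'a :: comm_ring_1 fps) a r b c = (if a + c < r + b then 0
    else fps_nth ((1 + fps_X) ^ (a - b - 1) * H) (a + c - (r + b)))"
proof -
  have "a - b - 1 + Suc b = a"
    using assms by simp
  then have "(1 + fps_X) ^ a * geom ^ Suc b = (1 + fps_X :: 'a fps) ^ (a - b - 1)"
    using one_plus_X_power_geom[of "a - b - 1" "Suc b"] by simp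
  then show ?thesis
    unfolding jt_entry_shift by simp
qed

lemma jt_entry_same:
  "jt_entry H a r a r = fps_nth H 0"
proof -
  have "fps_nth (geom ^ Suc a :: 'a fps) 0 = 1"
    by (simp add: geom_def fps_power_zeroth del: power_Suc)
  then show ?thesis
    by (simp add: jt_entry_shift fps_power_zeroth del: power_Suc)
qed

text \<open>
  For equal shapes the matrix is upper unitriangular. If \<open>b j < a j\<close>, the entries above and to the right
  of \<open>(j, j)\<close>, inclusively, are coefficients of \<open>(1 + z)\<^bsup>p\<^esup>\<close> in degrees above \<open>p\<close>.
\<close>
lemma jt_det_no_variables:
  assumes "antimono_on {..<n} a" and "antimono_on {..<n} b" and le: "\<And>j. j < n \<Longrightarrow> b j \<le> a j"
  shows "jt_det n (1 :: 'a :: comm_ring_1 fps) a b = (if \<forall>j<n. a j \<le> b j then 1 else 0)"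
proof (cases "\<forall>j<n. a j \<le> b j")
  case True
  then have eq: "b j = a j" if "j < n" for j
    using le that by (simp add: order_antisym)
  let ?A = "mat n n (\<lambda>(r, c). jt_entry (1 :: 'a fps) (a r) r (b c) c)"
  have A: "?A \<in> carrier_mat n n"
    by simp
  have "upper_triangular ?A"
  proof (rule upper_triangularI)
    fix r c assume rc: "c < r" "r < dim_row ?A"
    then have "a r \<le> a c"
      using assms(1) by (auto simp: monotone_on_def)
    then show "?A $$ (r, c) = 0"
      using rc by (simp add: eq jt_entry_eq_0)
  qed
  then have "det ?A = prod_list (diag_mat ?A)"
    using A by (rule det_upper_triangular)
  also have "diag_mat ?A = map (\<lambda>_. 1) [0..<n]"
    by (auto simp: diag_mat_def eq jt_entry_same)
  finally show ?thesis
    using True by (simp add: jt_det_def map_replicate_const)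
next
  case False
  then obtain j where j: "j < n" "b j < a j"
    by (auto simp: not_le)
  have "jt_det n (1 :: 'a fps) a b = 0"
    unfolding jt_det_def
  proof (rule det_zero_block[where C = "{j..<n}" and R = "{0..j}"])
    fix r c assume rc: "r \<in> {0..j}" "c \<in> {j..<n}"
    then have "b c \<le> b j" and "a j \<le> a r"
      using assms(1,2) j by (auto simp: monotone_on_def)
    then show "jt_entry 1 (a r) r (b c) c = (0 :: 'a)"
      using j rc by (subst jt_entry_above) (auto simp: one_plus_X_power_nth binomial_eq_0)
  qed (use j in auto)
  then show ?thesis
    using False by simp
qed

section \<open>Removing the smallest value from reverse plane partitions\<close>

text \<open>
  The skew diagram with the cells \<open>b c + 1, \<dots>, a c\<close> in column \<open>c + 1\<close>: columns are numbered from 0 in \<open>a\<close>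
  and \<open>b\<close>, to match matrix indices, but from 1 in diagrams.
\<close>
definition column_shape :: "nat \<Rightarrow> (nat \<Rightarrow> nat) \<Rightarrow> (nat \<Rightarrow> nat) \<Rightarrow> (nat \<times> nat) set" where
  "column_shape n a b = {(i, Suc c) | i c. c < n \<and> b c < i \<and> i \<le> a c}"

lemma mem_column_shape [simp]:
  "(i, Suc c) \<in> column_shape n a b \<longleftrightarrow> c < n \<and> b c < i \<and> i \<le> a c"
  "(i, 0) \<notin> column_shape n a b"
  by (auto simp: column_shape_def)

lemma finite_column_shape: "finite (column_shape n a b)"
proof -
  have "column_shape n a b \<subseteq> (\<Union>c<n. {..a c} \<times> {Suc c})"
    by (auto simp: column_shape_def)
  then show ?thesis
    by (rule finite_subset) auto
qed

definition bounded_rpps :: "(nat \<times> nat) set \<Rightarrow> nat \<Rightarrow> nat \<Rightarrow> (nat \<times> nat \<Rightarrow> nat) set" where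
  "bounded_rpps D l N = {R \<in> rpps D. \<forall>p\<in>D. l < R p \<and> R p \<le> N}"

definition rpp_gf ::
  "(nat \<Rightarrow> 'a :: comm_ring_1) \<Rightarrow> nat \<Rightarrow> nat \<Rightarrow> (nat \<times> nat) set \<Rightarrow> 'a" where
  "rpp_gf x l N D = (\<Sum>R\<in>bounded_rpps D l N. \<Prod>v\<in>{l<..N}. x v ^ columns_containing D R v)"

lemma finite_bounded_rpps:
  assumes "finite D"
  shows "finite (bounded_rpps D l N)"
proof (rule finite_subset)
  show "bounded_rpps D l N \<subseteq> PiE D (\<lambda>_. {..N})"
    by (auto simp: bounded_rpps_def rpps_def PiE_def)
  show "finite (PiE D (\<lambda>_. {..N}))"
    using assms by (intro finite_PiE) auto
qed

lemma column_shapeE: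
  assumes "p \<in> column_shape n a b"
  obtains i c where "p = (i, Suc c)" "c < n" "b c < i" "i \<le> a c"
  using assms by (auto simp: column_shape_def)

lemma bounded_rpps_column_shape_iff:
  "R \<in> bounded_rpps (column_shape n a b) l N \<longleftrightarrow>
     R \<in> extensional (column_shape n a b) \<and>
     (\<forall>c<n. \<forall>i. b c < i \<longrightarrow> i \<le> a c \<longrightarrow> l < R (i, Suc c) \<and> R (i, Suc c) \<le> N) \<and>
     (\<forall>c c' i. c \<le> c' \<longrightarrow> c' < n \<longrightarrow> b c < i \<longrightarrow> i \<le> a c \<longrightarrow> b c' < i \<longrightarrow> i \<le> a c' \<longrightarrow>
        R (i, Suc c) \<le> R (i, Suc c')) \<and>
     (\<forall>c i i'. c < n \<longrightarrow> b c < i \<longrightarrow> i \<le> i' \<longrightarrow> i' \<le> a c \<longrightarrow> R (i, Suc c) \<le> R (i', Suc c))"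
  (is "?L \<longleftrightarrow> ?ext \<and> ?bd \<and> ?row \<and> ?col")
proof
  assume L: ?L
  have ?ext ?bd
    using L by (auto simp: bounded_rpps_def rpps_def PiE_def)
  moreover have ?row
  proof (intro allI impI)
    fix c c' i assume "c \<le> c'" "c' < n" "b c < i" "i \<le> a c" "b c' < i" "i \<le> a c'"
    moreover have "\<forall>i j j'. (i, j) \<in> column_shape n a b \<and> (i, j') \<in> column_shape n a b \<and> j \<le> j'
        \<longrightarrow> R (i, j) \<le> R (i, j')"
      using L by (simp add: bounded_rpps_def rpps_def)
    ultimately show "R (i, Suc c) \<le> R (i, Suc c')"
      by simp
  qed
  moreover have ?col
  proof (intro allI impI)
    fix c i i' assume "c < n" "b c < i" "i \<le> i'" "i' \<le> a c"
    moreover have "\<forall>i i' j. (i, j) \<in> column_shape n a b \<and> (i', j) \<in> column_shape n a b \<and> i \<le> i'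
        \<longrightarrow> R (i, j) \<le> R (i', j)"
      using L by (simp add: bounded_rpps_def rpps_def)
    ultimately show "R (i, Suc c) \<le> R (i', Suc c)"
      by simp
  qed
  ultimately show "?ext \<and> ?bd \<and> ?row \<and> ?col"
    by blast
next
  assume *: "?ext \<and> ?bd \<and> ?row \<and> ?col"
  have bd: "l < R p \<and> R p \<le> N" if "p \<in> column_shape n a b" for p
    using that * by (elim column_shapeE) auto
  moreover have "R (i, j) \<le> R (i, j')"
    if "(i, j) \<in> column_shape n a b" "(i, j') \<in> column_shape n a b" "j \<le> j'" for i j j'
    using that * by (cases j; cases j') auto
  moreover have "R (i, j) \<le> R (i', j)"
    if "(i, j) \<in> column_shape n a b" "(i', j) \<in> column_shape n a b" "i \<le> i'" for i i' j
    using that * by (cases j) auto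
  moreover have "R p \<in> {1..}" if "p \<in> column_shape n a b" for p
    using bd[OF that] by simp
  ultimately show ?L
    using * by (auto simp: bounded_rpps_def rpps_def PiE_def simp del: mem_column_shape)
qed

lemma bounded_rpps_column_shapeD:
  assumes "R \<in> bounded_rpps (column_shape n a b) l N"
  shows bounded_rpps_outside: "p \<notin> column_shape n a b \<Longrightarrow> R p = undefined"
    and bounded_rpps_bounds:
      "c < n \<Longrightarrow> b c < i \<Longrightarrow> i \<le> a c \<Longrightarrow> l < R (i, Suc c) \<and> R (i, Suc c) \<le> N"
    and bounded_rpps_row: "c \<le> c' \<Longrightarrow> c' < n \<Longrightarrow> b c < i \<Longrightarrow> i \<le> a c \<Longrightarrow>
      b c' < i \<Longrightarrow> i \<le> a c' \<Longrightarrow> R (i, Suc c) \<le> R (i, Suc c')"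
    and bounded_rpps_column: "c < n \<Longrightarrow> b c < i \<Longrightarrow> i \<le> i' \<Longrightarrow> i' \<le> a c \<Longrightarrow>
      R (i, Suc c) \<le> R (i', Suc c)"
  using assms unfolding bounded_rpps_column_shape_iff extensional_def by blast+

text \<open>
  Used to see that the cells of a column with the smallest allowed value are its topmost ones.
\<close>
lemma down_closed_in_interval:
  fixes b a :: nat
  assumes "S \<subseteq> {b<..a}" and "\<And>i i'. i' \<in> S \<Longrightarrow> b < i \<Longrightarrow> i \<le> i' \<Longrightarrow> i \<in> S"
  shows "S = {b<..b + card S}"
proof (cases "S = {}")
  case False
  have fin: "finite S"
    using assms(1) by (rule finite_subset) simp
  have "S = {b<..Max S}"
    using Max_in[OF fin False] assms Max_ge[OF fin] by (auto intro: assms(2)[of "Max S"])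
  moreover have "b < Max S"
    using Max_in[OF fin False] assms(1) by auto
  moreover from calculation have "card S = Max S - b"
    by (metis card_greaterThanAtMost)
  ultimately show ?thesis
    by simp
qed simp

text \<open>
  If \<open>v\<close> is the smallest allowed value, the cells of \<open>R\<close> containing \<open>v\<close> are the cells of column \<open>c\<close> down
  to row \<open>cut_height n a b v R c\<close>. The function is undefined outside \<open>{..<n}\<close>, so that it is an
  element of an extensional function space, as in the expansion of the determinant.
\<close>
definition cut_height :: "nat \<Rightarrow> (nat \<Rightarrow> nat) \<Rightarrow> (nat \<Rightarrow> nat) \<Rightarrow> nat \<Rightarrow> (nat \<times> nat \<Rightarrow> nat) \<Rightarrow> nat \<Rightarrow> nat" where
  "cut_height n a b v R = (\<lambda>c\<in>{..<n}. b c + card {i \<in> {b c<..a c}. R (i, Suc c) = v})"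

lemma cut_height_iff:
  assumes R: "R \<in> bounded_rpps (column_shape n a b) l N" and c: "c < n" and i: "b c < i" "i \<le> a c"
  shows "R (i, Suc c) = Suc l \<longleftrightarrow> i \<le> cut_height n a b (Suc l) R c"
proof -
  let ?S = "{i \<in> {b c<..a c}. R (i, Suc c) = Suc l}"
  have "?S = {b c<..b c + card ?S}"
  proof (rule down_closed_in_interval)
    fix i i' assume i': "i' \<in> ?S" "b c < i" "i \<le> i'"
    then have "l < R (i, Suc c)" and "R (i, Suc c) \<le> R (i', Suc c)"
      using bounded_rpps_bounds[OF R, of c i] bounded_rpps_column[OF R, of c i i'] c by auto
    then show "i \<in> ?S"
      using i' by auto
  qed auto
  then have "i \<in> ?S \<longleftrightarrow> i \<in> {b c<..b c + card ?S}"
    by (rule arg_cong)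
  then show ?thesis
    using c i by (simp add: cut_height_def)
qed

lemma cut_height_bounds:
  assumes "c < n" and "b c \<le> a c"
  shows "b c \<le> cut_height n a b v R c" and "cut_height n a b v R c \<le> a c"
proof -
  have "card {i \<in> {b c<..a c}. R (i, Suc c) = v} \<le> card {b c<..a c}"
    by (intro card_mono) auto
  then show "b c \<le> cut_height n a b v R c" "cut_height n a b v R c \<le> a c"
    using assms by (simp_all add: cut_height_def)
qed

text \<open>
  If column \<open>c'\<close> has the smallest value in row \<open>h c' > h c\<close>, then that row also meets column \<open>c\<close> inside
  the shape, and the entry there is at most as large, so it is the smallest value too.
\<close>
lemma antimono_cut_height:
  assumes R: "R \<in> bounded_rpps (column_shape n a b) l N"
    and a: "antimono_on {..<n} a" and b: "antimono_on {..<n} b" and le: "\<And>c. c < n \<Longrightarrow> b c \<le> a c"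
  shows "antimono_on {..<n} (cut_height n a b (Suc l) R)"
proof (rule monotone_onI, rule ccontr)
  fix c c' assume cc': "c \<in> {..<n}" "c' \<in> {..<n}" "c \<le> c'"
  let ?h = "cut_height n a b (Suc l) R"
  assume "\<not> ?h c' \<le> ?h c"
  then have lt: "?h c < ?h c'"
    by simp
  have ab: "a c' \<le> a c" "b c' \<le> b c"
    using a b cc' by (auto simp: monotone_on_def)
  have hb: "b c \<le> ?h c" "?h c' \<le> a c'"
    using cut_height_bounds[of c n b a] cut_height_bounds[of c' n b a] le cc' by auto
  have "R (?h c', Suc c') = Suc l"
    using cut_height_iff[OF R, of c' "?h c'"] cc' ab hb lt by auto
  moreover have "R (?h c', Suc c) \<le> R (?h c', Suc c')" and "l < R (?h c', Suc c)"
    using bounded_rpps_row[OF R, of c c' "?h c'"] bounded_rpps_bounds[OF R, of c "?h c'"]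
      cc' ab hb lt by auto
  ultimately have "?h c' \<le> ?h c"
    using cut_height_iff[OF R, of c "?h c'"] cc' ab hb lt by auto
  with lt show False
    by simp
qed

lemma columns_containing_column_shape:
  "columns_containing (column_shape n a b) R v =
     card {c. c < n \<and> (\<exists>i. b c < i \<and> i \<le> a c \<and> R (i, Suc c) = v)}"
proof -
  have "{j. \<exists>i. (i, j) \<in> column_shape n a b \<and> R (i, j) = v} =
      Suc ` {c. c < n \<and> (\<exists>i. b c < i \<and> i \<le> a c \<and> R (i, Suc c) = v)}"
    by (auto simp: column_shape_def)
  then show ?thesis
    by (simp add: columns_containing_def card_image)
qed

definition glue :: "nat \<Rightarrow> (nat \<Rightarrow> nat) \<Rightarrow> nat \<Rightarrow> (nat \<Rightarrow> nat) \<times> (nat \<times> nat \<Rightarrow> nat) \<Rightarrow> nat \<times> nat \<Rightarrow> nat" where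
  "glue n b v = (\<lambda>(h, R) p. if p \<in> column_shape n h b then v else R p)"

lemma glue_in_bounded_rpps:
  assumes h: "h \<in> PiE {..<n} (\<lambda>c. {b c..a c})" "antimono_on {..<n} h"
    and R: "R \<in> bounded_rpps (column_shape n a h) (Suc l) N" and "l < N"
  shows "glue n b (Suc l) (h, R) \<in> bounded_rpps (column_shape n a b) l N"
proof -
  have hb: "b c \<le> h c" "h c \<le> a c" if "c < n" for c
    using PiE_mem[OF h(1), of c] that by auto
  have R': "Suc l < R (i, Suc c)" "R (i, Suc c) \<le> N" if "c < n" "h c < i" "i \<le> a c" for c i
    using bounded_rpps_bounds[OF R, of c i] that by auto
  have low: "i \<le> h c" if "c \<le> c'" "c' < n" "i \<le> h c'" for c c' i
    using monotone_onD[OF h(2), of c c'] that by auto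
  show ?thesis
    unfolding bounded_rpps_column_shape_iff
  proof (intro conjI allI impI)
    show "glue n b (Suc l) (h, R) \<in> extensional (column_shape n a b)"
      unfolding extensional_def
    proof (intro CollectI allI impI)
      fix p assume p: "p \<notin> column_shape n a b"
      have "p \<notin> column_shape n h b" "p \<notin> column_shape n a h"
        using p hb by (fastforce elim!: column_shapeE)+
      then show "glue n b (Suc l) (h, R) p = undefined"
        using bounded_rpps_outside[OF R] by (simp add: glue_def)
    qed
  next
    fix c i assume "c < n" "b c < i" "i \<le> a c"
    then show "l < glue n b (Suc l) (h, R) (i, Suc c)" "glue n b (Suc l) (h, R) (i, Suc c) \<le> N"
      using R'[of c i] \<open>l < N\<close> by (auto simp: glue_def)
  next
    fix c c' i assume "c \<le> c'" "c' < n" "b c < i" "i \<le> a c" "b c' < i" "i \<le> a c'"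
    then show "glue n b (Suc l) (h, R) (i, Suc c) \<le> glue n b (Suc l) (h, R) (i, Suc c')"
      using bounded_rpps_row[OF R, of c c' i] R'(1)[of c' i] low[of c c' i]
      by (auto simp: glue_def)
  next
    fix c i i' assume "c < n" "b c < i" "i \<le> i'" "i' \<le> a c"
    then show "glue n b (Suc l) (h, R) (i, Suc c) \<le> glue n b (Suc l) (h, R) (i', Suc c)"
      using bounded_rpps_column[OF R, of c i i'] R'(1)[of c i'] by (auto simp: glue_def)
  qed
qed

lemma cut_height_glue:
  assumes h: "h \<in> PiE {..<n} (\<lambda>c. {b c..a c})"
    and R: "R \<in> bounded_rpps (column_shape n a h) (Suc l) N"
  shows "cut_height n a b (Suc l) (glue n b (Suc l) (h, R)) = h"
proof
  fix c
  show "cut_height n a b (Suc l) (glue n b (Suc l) (h, R)) c = h c"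
  proof (cases "c < n")
    case True
    have hb: "b c \<le> h c" "h c \<le> a c"
      using PiE_mem[OF h, of c] True by auto
    have "glue n b (Suc l) (h, R) (i, Suc c) = Suc l \<longleftrightarrow> i \<le> h c" if "b c < i" "i \<le> a c" for i
      using bounded_rpps_bounds[OF R, of c i] that True by (cases "i \<le> h c") (auto simp: glue_def)
    then have "{i \<in> {b c<..a c}. glue n b (Suc l) (h, R) (i, Suc c) = Suc l} = {b c<..h c}"
      using hb by auto
    then show ?thesis
      using hb True by (simp add: cut_height_def)
  next
    case False
    then show ?thesis
      using h by (auto simp: cut_height_def PiE_def extensional_def)
  qed
qed

lemma restrict_glue:
  assumes "R \<in> bounded_rpps (column_shape n a h) (Suc l) N"
  shows "restrict (glue n b v (h, R)) (column_shape n a h) = R"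
proof
  fix p
  show "restrict (glue n b v (h, R)) (column_shape n a h) p = R p"
  proof (cases "p \<in> column_shape n a h")
    case True
    then have "p \<notin> column_shape n h b"
      by (auto elim!: column_shapeE)
    with True show ?thesis
      by (simp add: glue_def)
  next
    case False
    then show ?thesis
      using bounded_rpps_outside[OF assms] by simp
  qed
qed

lemma split_at_cut:
  assumes R: "R \<in> bounded_rpps (column_shape n a b) l N" and le: "\<And>c. c < n \<Longrightarrow> b c \<le> a c"
  defines "h \<equiv> cut_height n a b (Suc l) R"
  shows "restrict R (column_shape n a h) \<in> bounded_rpps (column_shape n a h) (Suc l) N" (is ?mem)
    and "glue n b (Suc l) (h, restrict R (column_shape n a h)) = R" (is ?glue)
proof -
  have hb: "b c \<le> h c" "h c \<le> a c" if "c < n" for c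
    using cut_height_bounds[of c n b a] le that by (auto simp: h_def)
  have cut: "R (i, Suc c) = Suc l \<longleftrightarrow> i \<le> h c" if "c < n" "b c < i" "i \<le> a c" for i c
    unfolding h_def using cut_height_iff[OF R that] .
  have big: "Suc l < R (i, Suc c) \<and> b c < i" if "c < n" "h c < i" "i \<le> a c" for i c
  proof -
    have "b c < i"
      using hb that by (meson le_less_trans)
    moreover have "l < R (i, Suc c)"
      using bounded_rpps_bounds[OF R, of c i] that calculation by auto
    ultimately show ?thesis
      using cut[of c i] that by linarith
  qed
  show ?mem
    using R big by (auto simp: bounded_rpps_column_shape_iff)
  show ?glue
  proof
    fix p
    show "glue n b (Suc l) (h, restrict R (column_shape n a h)) p = R p"
    proof (cases "p \<in> column_shape n a b")
      case True
      then obtain i c where "p = (i, Suc c)" "c < n" "b c < i" "i \<le> a c"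
        by (rule column_shapeE)
      then show ?thesis
        using cut[of c i] by (auto simp: glue_def not_le)
    next
      case False
      then have "p \<notin> column_shape n h b" "p \<notin> column_shape n a h"
        using hb by (fastforce elim!: column_shapeE)+
      then show ?thesis
        using bounded_rpps_outside[OF R False] by (simp add: glue_def)
    qed
  qed
qed

text \<open>
  The new value \<open>Suc l\<close> fills the cells between \<open>b\<close> and \<open>h\<close>, so exactly the columns with \<open>b c < h c\<close>
  contain it, and all other values stay in their columns.
\<close>
lemma glue_weight:
  assumes h: "h \<in> PiE {..<n} (\<lambda>c. {b c..a c})"
    and R: "R \<in> bounded_rpps (column_shape n a h) (Suc l) N" and "l < N"
  shows "(\<Prod>v\<in>{l<..N}. x v ^ columns_containing (column_shape n a b) (glue n b (Suc l) (h, R)) v) =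
    (\<Prod>c<n. if b c < h c then x (Suc l) else 1) *
    (\<Prod>v\<in>{Suc l<..N}. x v ^ columns_containing (column_shape n a h) R v)"
proof -
  let ?Q = "glue n b (Suc l) (h, R)"
  have hb: "b c \<le> h c" "h c \<le> a c" if "c < n" for c
    using PiE_mem[OF h, of c] that by auto
  have Q: "?Q (i, Suc c) = (if i \<le> h c then Suc l else R (i, Suc c))"
    if "c < n" "b c < i" "i \<le> a c" for i c
    using that by (simp add: glue_def)
  have R': "Suc l < R (i, Suc c)" if "c < n" "h c < i" "i \<le> a c" for c i
    using bounded_rpps_bounds[OF R, of c i] that by auto
  have "(\<exists>i. b c < i \<and> i \<le> a c \<and> ?Q (i, Suc c) = Suc l) \<longleftrightarrow> b c < h c" if c: "c < n" for c
  proof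
    assume "\<exists>i. b c < i \<and> i \<le> a c \<and> ?Q (i, Suc c) = Suc l"
    then obtain i where "b c < i" "i \<le> a c" "?Q (i, Suc c) = Suc l"
      by auto
    then show "b c < h c"
      using c R'[of c i] by (cases "i \<le> h c") (auto simp: Q)
  next
    assume "b c < h c"
    then show "\<exists>i. b c < i \<and> i \<le> a c \<and> ?Q (i, Suc c) = Suc l"
      using hb[OF c] c by (intro exI[of _ "h c"]) (simp add: Q)
  qed
  then have "columns_containing (column_shape n a b) ?Q (Suc l) = card {c. c < n \<and> b c < h c}"
    unfolding columns_containing_column_shape by (intro arg_cong[of _ _ card]) auto
  moreover have "(\<Prod>c<n. if b c < h c then x (Suc l) else 1) = x (Suc l) ^ card {c. c < n \<and> b c < h c}"
    by (simp add: prod.If_cases Int_def)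
  moreover have "columns_containing (column_shape n a b) ?Q v = columns_containing (column_shape n a h) R v"
    if v: "v \<in> {Suc l<..N}" for v
  proof -
    have "(b c < i \<and> i \<le> a c \<and> ?Q (i, Suc c) = v) \<longleftrightarrow> (h c < i \<and> i \<le> a c \<and> R (i, Suc c) = v)"
      if "c < n" for c i
      using that v hb[OF that] by (cases "b c < i \<and> i \<le> a c") (auto simp: Q)
    then show ?thesis
      unfolding columns_containing_column_shape by (intro arg_cong[of _ _ card]) auto
  qed
  moreover have "{l<..N} = insert (Suc l) {Suc l<..N}"
    using \<open>l < N\<close> by auto
  ultimately show ?thesis
    by simp
qed

text \<open>
  Cutting off the cells with value \<open>Suc l\<close> is a bijection onto pairs of an intermediate shape \<open>h\<close> and a
  filling of the rest with larger values. Repetitions of a value within a column are permitted, so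
  that any decreasing \<open>h\<close> between \<open>b\<close> and \<open>a\<close> arises.
\<close>
lemma rpp_gf_peel_smallest:
  assumes a: "antimono_on {..<n} a" and b: "antimono_on {..<n} b"
    and le: "\<And>c. c < n \<Longrightarrow> b c \<le> a c" and "l < N"
  shows "rpp_gf x l N (column_shape n a b) =
    (\<Sum>h\<in>{h \<in> PiE {..<n} (\<lambda>c. {b c..a c}). antimono_on {..<n} h}.
       (\<Prod>c<n. if b c < h c then x (Suc l) else 1) * rpp_gf x (Suc l) N (column_shape n a h))"
proof -
  let ?H = "{h \<in> PiE {..<n} (\<lambda>c. {b c..a c}). antimono_on {..<n} h}"
  let ?P = "Sigma ?H (\<lambda>h. bounded_rpps (column_shape n a h) (Suc l) N)"
  let ?w = "\<lambda>h. \<Prod>c<n. if b c < h c then x (Suc l) else 1"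
  have "rpp_gf x l N (column_shape n a b) =
      (\<Sum>(h, R)\<in>?P. ?w h * (\<Prod>v\<in>{Suc l<..N}. x v ^ columns_containing (column_shape n a h) R v))"
    unfolding rpp_gf_def
  proof (rule sum.reindex_bij_witness[where i = "glue n b (Suc l)" and
        j = "\<lambda>R. (cut_height n a b (Suc l) R, restrict R (column_shape n a (cut_height n a b (Suc l) R)))"])
    fix R assume R: "R \<in> bounded_rpps (column_shape n a b) l N"
    let ?h = "cut_height n a b (Suc l) R"
    show "glue n b (Suc l) (?h, restrict R (column_shape n a ?h)) = R"
      by (rule split_at_cut(2)[OF R le])
    have h: "?h \<in> PiE {..<n} (\<lambda>c. {b c..a c})"
      using cut_height_bounds[of _ n b a] le by (auto simp: cut_height_def)
    show "(?h, restrict R (column_shape n a ?h)) \<in> ?P"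
      using h antimono_cut_height[OF R a b le] split_at_cut(1)[OF R le] by simp
    show "(case (?h, restrict R (column_shape n a ?h)) of (h, R) \<Rightarrow>
        ?w h * (\<Prod>v\<in>{Suc l<..N}. x v ^ columns_containing (column_shape n a h) R v)) =
        (\<Prod>v\<in>{l<..N}. x v ^ columns_containing (column_shape n a b) R v)"
      using glue_weight[OF h split_at_cut(1)[OF R le] \<open>l < N\<close>, of x] split_at_cut(2)[OF R le] by simp
  next
    fix q assume "q \<in> ?P"
    then obtain h R where q: "q = (h, R)" and h: "h \<in> PiE {..<n} (\<lambda>c. {b c..a c})"
      "antimono_on {..<n} h" and R: "R \<in> bounded_rpps (column_shape n a h) (Suc l) N"
      by auto
    show "glue n b (Suc l) q \<in> bounded_rpps (column_shape n a b) l N"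
      unfolding q by (rule glue_in_bounded_rpps[OF h R \<open>l < N\<close>])
    show "(cut_height n a b (Suc l) (glue n b (Suc l) q), restrict (glue n b (Suc l) q)
        (column_shape n a (cut_height n a b (Suc l) (glue n b (Suc l) q)))) = q"
      unfolding q cut_height_glue[OF h(1) R] restrict_glue[OF R] ..
  qed
  also have "\<dots> = (\<Sum>h\<in>?H. ?w h * rpp_gf x (Suc l) N (column_shape n a h))"
    unfolding rpp_gf_def sum_distrib_left
    by (rule sum.Sigma[symmetric])
      (auto intro!: finite_bounded_rpps finite_column_shape finite_PiE
         intro: finite_subset[of _ "PiE {..<n} (\<lambda>c. {b c..a c})"])
  finally show ?thesis .
qed

lemma rpp_gf_no_values:
  "rpp_gf x N N (column_shape n a b) = (if \<forall>c<n. a c \<le> b c then 1 else 0)"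
proof (cases "\<forall>c<n. a c \<le> b c")
  case True
  then have "column_shape n a b = {}"
    by (force elim!: column_shapeE)
  then have "bounded_rpps (column_shape n a b) N N = {\<lambda>_. undefined}"
    by (simp add: bounded_rpps_def rpps_def)
  with True show ?thesis
    by (simp add: rpp_gf_def)
next
  case False
  then obtain c where "c < n" "b c < a c"
    by (auto simp: not_le)
  then have "R \<notin> bounded_rpps (column_shape n a b) N N" for R
    using bounded_rpps_bounds[of R n a b N N c "a c"] by auto
  then have "bounded_rpps (column_shape n a b) N N = {}"
    by blast
  with False show ?thesis
    by (simp add: rpp_gf_def)
qed

section \<open>The identity in finitely many variables\<close>

text \<open>
  The generating function of the elementary symmetric polynomials in the variables \<open>x v\<close>, \<open>v \<in> A\<close>.
\<close>
definition elem_gf :: "(nat \<Rightarrow> 'a :: comm_ring_1) \<Rightarrow> nat set \<Rightarrow> 'a fps" where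
  "elem_gf x A = (\<Prod>v\<in>A. 1 + fps_const (x v) * fps_X)"

lemma elem_gf_nth:
  assumes "finite A"
  shows "fps_nth (elem_gf x A) k = (\<Sum>S | S \<subseteq> A \<and> card S = k. \<Prod>v\<in>S. x v)"
proof -
  have term_eq: "(\<Prod>v\<in>S. fps_const (x v) * fps_X) = fps_const (\<Prod>v\<in>S. x v) * fps_X ^ card S" for S
    by (induction S rule: infinite_finite_induct) (simp_all add: mult_ac flip: fps_const_mult)
  have "elem_gf x A = (\<Prod>v\<in>A. fps_const (x v) * fps_X + 1)"
    by (simp add: elem_gf_def add.commute)
  also have "\<dots> = (\<Sum>S\<in>Pow A. fps_const (\<Prod>v\<in>S. x v) * fps_X ^ card S)"
    by (subst prod_add[OF assms]) (simp add: term_eq)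
  finally have "fps_nth (elem_gf x A) k = (\<Sum>S\<in>Pow A. if card S = k then \<Prod>v\<in>S. x v else 0)"
    by (auto simp: fps_sum_nth intro!: sum.cong)
  also have "\<dots> = (\<Sum>S | S \<subseteq> A \<and> card S = k. \<Prod>v\<in>S. x v)"
    using assms by (subst sum.inter_filter[symmetric]) (auto intro: sum.cong)
  finally show ?thesis .
qed

lemma jt_det_eq_rpp_gf:
  assumes a: "antimono_on {..<n} a" and b: "antimono_on {..<n} b"
    and "\<And>c. c < n \<Longrightarrow> b c \<le> a c" and "l \<le> N"
  shows "jt_det n (elem_gf x {l<..N}) a b = rpp_gf x l N (column_shape n a b)"
  using assms(4,2,3)
proof (induction l arbitrary: b rule: inc_induct)
  case base
  then show ?case
    by (simp add: elem_gf_def rpp_gf_no_values jt_det_no_variables[OF a base.prems])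
next
  case (step l)
  have "{l<..N} = insert (Suc l) {Suc l<..N}"
    using step.hyps by auto
  then have "elem_gf x {l<..N} = (1 + fps_const (x (Suc l)) * fps_X) * elem_gf x {Suc l<..N}"
    by (simp add: elem_gf_def)
  then have "jt_det n (elem_gf x {l<..N}) a b =
      (\<Sum>h\<in>{h \<in> PiE {..<n} (\<lambda>c. {b c..a c}). antimono_on {..<n} h}.
         (\<Prod>c<n. if b c < h c then x (Suc l) else 1) * jt_det n (elem_gf x {Suc l<..N}) a h)"
    by (simp only: jt_det_add_variable[OF a step.prems(1)])
  also have "\<dots> = (\<Sum>h\<in>{h \<in> PiE {..<n} (\<lambda>c. {b c..a c}). antimono_on {..<n} h}.
      (\<Prod>c<n. if b c < h c then x (Suc l) else 1) * rpp_gf x (Suc l) N (column_shape n a h))"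
  proof (intro sum.cong refl arg_cong2[of _ _ _ _ "(*)"] step.IH)
    fix h c assume "h \<in> {h \<in> PiE {..<n} (\<lambda>c. {b c..a c}). antimono_on {..<n} h}" "c < n"
    then show "h c \<le> a c"
      using PiE_mem[of h "{..<n}" "\<lambda>c. {b c..a c}" c] by simp
  qed simp
  also have "\<dots> = rpp_gf x l N (column_shape n a b)"
    by (rule rpp_gf_peel_smallest[OF a step.prems step.hyps(2), symmetric])
  finally show ?case .
qed

section \<open>Binomial entries\<close>

definition coeff_int :: "'a :: zero fps \<Rightarrow> int \<Rightarrow> 'a" where
  "coeff_int H k = (if k < 0 then 0 else fps_nth H (nat k))"

text \<open>
  The summation range \<open>k \<le> a\<close> contains all \<open>k\<close> with nonzero binomial coefficient, including \<open>k = 0\<close> in the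
  case \<open>a \<le> b\<close>.
\<close>
definition binom_entry :: "'a :: comm_ring_1 fps \<Rightarrow> nat \<Rightarrow> nat \<Rightarrow> nat \<Rightarrow> nat \<Rightarrow> 'a" where
  "binom_entry H a r b c = (\<Sum>k\<le>a. of_nat (binom (int a - int b - 1) k) *
     coeff_int H (int a - int b - int r + int c - int k))"

lemma binom_entry_below:
  assumes "a \<le> b"
  shows "binom_entry H a r b c = coeff_int H (int a - int b - int r + int c)"
proof -
  have "binom_entry H a r b c = (\<Sum>k\<in>{0}. of_nat (binom (int a - int b - 1) k) *
     coeff_int H (int a - int b - int r + int c - int k))"
    unfolding binom_entry_def using assms
    by (intro sum.mono_neutral_right) (auto simp: binom_def)
  then show ?thesis
    using assms by (simp add: binom_def)
qed

lemma binom_entry_above: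
  assumes "b < a"
  shows "binom_entry H a r b c = jt_entry H a r b c"
proof -
  define p where "p = a - b - 1"
  have bin: "binom (int a - int b - 1) k = p choose k" for k
  proof -
    have "int a - int b - 1 = int p"
      using assms by (simp add: p_def)
    then show ?thesis
      by (simp add: binom_def)
  qed
  show ?thesis
  proof (cases "a + c < r + b")
    case True
    then show ?thesis
      by (simp add: jt_entry_eq_0 binom_entry_def coeff_int_def)
  next
    case False
    define m where "m = a + c - (r + b)"
    have m: "int a - int b - int r + int c - int k = int m - int k" for k
      using False by (simp add: m_def)
    let ?t = "\<lambda>k. of_nat (p choose k) * coeff_int H (int m - int k)"
    have high: "p choose k = 0" if "a < k" for k
      using that by (simp add: p_def binomial_eq_0)
    have "binom_entry H a r b c = (\<Sum>k\<le>a. ?t k)"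
      by (simp only: binom_entry_def bin m)
    also have "\<dots> = (\<Sum>k\<le>a + m. ?t k)"
      by (rule sum.mono_neutral_left) (auto simp: high)
    also have "\<dots> = (\<Sum>k\<le>m. ?t k)"
      by (rule sum.mono_neutral_right) (auto simp: coeff_int_def)
    also have "\<dots> = (\<Sum>k\<le>m. of_nat (p choose k) * fps_nth H (m - k))"
      by (intro sum.cong) (auto simp: coeff_int_def nat_diff_distrib)
    also have "\<dots> = fps_nth ((1 + fps_X) ^ p * H) m"
      by (simp add: fps_mult_nth one_plus_X_power_nth atLeast0AtMost)
    also have "\<dots> = jt_entry H a r b c"
      using False by (simp add: jt_entry_above[OF assms] p_def m_def)
    finally show ?thesis .
  qed
qed

text \<open>
  The two kinds of entries differ only where \<open>a r \<le> b c\<close> and \<open>r < c\<close>. There monotonicity gives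
  \<open>a r' \<le> b c'\<close> for all \<open>r' > r\<close> and \<open>c' \<le> r\<close>, and all these entries are coefficients in negative degree, so
  \<open>det_cong_off_zero_blocks\<close> applies.
\<close>
lemma det_binom_entry:
  assumes a: "antimono_on {..<n} a" and b: "antimono_on {..<n} b" and H: "fps_nth H 0 = 1"
  shows "det (mat n n (\<lambda>(r, c). binom_entry H (a r) r (b c) c)) = jt_det n H a b"
  unfolding jt_det_def
proof (rule det_cong_off_zero_blocks)
  fix r c assume rc: "r < n" "c < n"
  have zero: "binom_entry H (a r) r (b c) c = 0 \<and> jt_entry H (a r) r (b c) c = 0"
    if "a r \<le> b c" "c \<le> r" "a r < b c \<or> c < r" for r c
    using that by (auto simp: binom_entry_below coeff_int_def intro!: jt_entry_eq_0)
  consider "b c < a r" | "a r \<le> b c" "r < c" | "a r = b c" "r = c"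
    | "a r \<le> b c" "c \<le> r" "a r < b c \<or> c < r"
    by linarith
  then show "binom_entry H (a r) r (b c) c = jt_entry H (a r) r (b c) c \<or>
      (r < c \<and> (\<forall>r' c'. r < r' \<longrightarrow> r' < n \<longrightarrow> c' \<le> r \<longrightarrow>
        binom_entry H (a r') r' (b c') c' = 0 \<and> jt_entry H (a r') r' (b c') c' = 0))"
  proof cases
    case 1
    then show ?thesis
      by (simp add: binom_entry_above)
  next
    case 2
    have "binom_entry H (a r') r' (b c') c' = 0 \<and> jt_entry H (a r') r' (b c') c' = 0"
      if "r < r'" "r' < n" "c' \<le> r" for r' c'
    proof (rule zero)
      have "a r' \<le> a r" and "b c \<le> b c'"
        using monotone_onD[OF a, of r r'] monotone_onD[OF b, of c' c] that rc 2 by auto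
      then show "a r' \<le> b c'"
        using 2 by simp
    qed (use that in auto)
    then show ?thesis
      using 2 by blast
  next
    case 3
    then have "binom_entry H (a r) r (b c) c = fps_nth H 0"
      by (simp add: binom_entry_below coeff_int_def)
    moreover have "jt_entry H (a r) r (b c) c = fps_nth H 0"
      using 3 jt_entry_same[of H "b c" c] by simp
    ultimately show ?thesis
      by simp
  next
    case 4
    then show ?thesis
      using zero by simp
  qed
qed

section \<open>Restriction to finitely many variables\<close>

text \<open>
  Substituting 0 for the variables beyond the \<open>N\<close>th.
\<close>
lift_definition truncate_vars ::
    "nat \<Rightarrow> (nat, 'a :: comm_ring_1) mfps \<Rightarrow> (nat, 'a) mfps"
  is "\<lambda>N f m. if Poly_Mapping.keys m \<subseteq> {..N} then f m else 0" .

lemma comm_ring_hom_truncate_vars: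
  "comm_ring_hom (truncate_vars N :: (nat, 'a :: comm_ring_1) mfps \<Rightarrow> _)"
proof
  fix f g :: "(nat, 'a) mfps"
  show "truncate_vars N (f * g) = truncate_vars N f * truncate_vars N g"
  proof (rule mfps_eqI)
    fix m :: "nat \<Rightarrow>\<^sub>0 nat"
    have keys: "Poly_Mapping.keys (p + q) = Poly_Mapping.keys p \<union> Poly_Mapping.keys q"
      for p q :: "nat \<Rightarrow>\<^sub>0 nat"
      by (auto simp: in_keys_iff lookup_add)
    show "mfps_coeff (truncate_vars N (f * g)) m =
        mfps_coeff (truncate_vars N f * truncate_vars N g) m"
      unfolding times_mfps.rep_eq truncate_vars.rep_eq
      by (auto simp: keys intro!: sum.cong sum.neutral)
  qed
qed (rule mfps_eqI; simp add: truncate_vars.rep_eq one_mfps.rep_eq zero_mfps.rep_eq plus_mfps.rep_eq)+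

lemma mfps_eqI_truncate_vars:
  fixes f g :: "(nat, 'a :: comm_ring_1) mfps"
  assumes "\<And>N. truncate_vars N f = truncate_vars N g"
  shows "f = g"
proof (rule mfps_eqI)
  fix m :: "nat \<Rightarrow>\<^sub>0 nat"
  define N where "N = Max (insert 0 (Poly_Mapping.keys m))"
  have "Poly_Mapping.keys m \<subseteq> {..N}"
    by (auto simp: N_def)
  then show "mfps_coeff f m = mfps_coeff g m"
    using arg_cong[OF assms[of N], of "\<lambda>h. mfps_coeff h m"] by (simp add: truncate_vars.rep_eq)
qed

lemma truncate_vars_var:
  "truncate_vars N (mfps_var i :: (nat, 'a :: comm_ring_1) mfps) = (if i \<le> N then mfps_var i else 0)"
  by (rule mfps_eqI) (auto simp: truncate_vars.rep_eq mfps_var.rep_eq zero_mfps.rep_eq)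

lemma mfps_coeff_sum: "mfps_coeff (sum f A) m = (\<Sum>a\<in>A. mfps_coeff (f a) m)"
  by (induction A rule: infinite_finite_induct) (simp_all add: zero_mfps.rep_eq plus_mfps.rep_eq)

text \<open>
  Truncation turns a formal sum into a finite one if it kills almost all members, because a coefficient
  that survives truncation is untouched by it.
\<close>
lemma truncate_vars_mfps_sum:
  assumes "finite B" and "B \<subseteq> A" and out: "\<And>a. a \<in> A - B \<Longrightarrow> truncate_vars N (f a) = 0"
  shows "truncate_vars N (mfps_sum f A) = (\<Sum>a\<in>B. truncate_vars N (f a))"
proof (rule mfps_eqI)
  fix m
  show "mfps_coeff (truncate_vars N (mfps_sum f A)) m =
      mfps_coeff (\<Sum>a\<in>B. truncate_vars N (f a)) m"
  proof (cases "Poly_Mapping.keys m \<subseteq> {..N}")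
    case True
    have "a \<in> B" if "a \<in> A" "mfps_coeff (f a) m \<noteq> 0" for a
    proof (rule ccontr)
      assume "a \<notin> B"
      then have "mfps_coeff (truncate_vars N (f a)) m = 0"
        using out[of a] that by (simp add: zero_mfps.rep_eq)
      with True that show False
        by (simp add: truncate_vars.rep_eq)
    qed
    then have "(\<Sum>a | a \<in> A \<and> mfps_coeff (f a) m \<noteq> 0. mfps_coeff (f a) m) = (\<Sum>a\<in>B. mfps_coeff (f a) m)"
      using assms(1,2) by (intro sum.mono_neutral_left) auto
    with True show ?thesis
      by (simp add: truncate_vars.rep_eq mfps_sum.rep_eq mfps_coeff_sum)
  qed (simp add: truncate_vars.rep_eq mfps_coeff_sum)
qed

lemma truncate_vars_esym:
  "truncate_vars N (esym k) = coeff_int (elem_gf mfps_var {0<..N}) k"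
proof -
  interpret comm_ring_hom "truncate_vars N :: (nat, int) mfps \<Rightarrow> _"
    by (rule comm_ring_hom_truncate_vars)
  let ?B = "{S. S \<subseteq> {0<..N} \<and> int (card S) = k}"
  let ?A = "{S. finite S \<and> S \<subseteq> {1..} \<and> int (card S) = k}"
  have "truncate_vars N (esym k) = (\<Sum>S\<in>?B. truncate_vars N (\<Prod>i\<in>S. mfps_var i))"
    unfolding esym_def
  proof (rule truncate_vars_mfps_sum)
    show "?B \<subseteq> ?A"
      by (auto intro: finite_subset)
    show "finite ?B"
      by (rule finite_subset[of _ "Pow {0<..N}"]) auto
    fix S assume "S \<in> ?A - ?B"
    then obtain i where "finite S" "i \<in> S" "N < i"
      by (fastforce simp: subset_iff)
    then show "truncate_vars N (\<Prod>i\<in>S. mfps_var i :: (nat, int) mfps) = 0"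
      unfolding hom_prod by (intro prod_zero) (auto simp: truncate_vars_var intro!: bexI[of _ i])
  qed
  also have "\<dots> = (\<Sum>S\<in>?B. \<Prod>i\<in>S. mfps_var i)"
    unfolding hom_prod by (intro sum.cong prod.cong) (auto simp: truncate_vars_var)
  also have "\<dots> = coeff_int (elem_gf mfps_var {0<..N}) k"
  proof (cases "k < 0")
    case False
    then have "(int m = k) = (m = nat k)" for m
      by auto
    then show ?thesis
      using False by (simp add: coeff_int_def elem_gf_nth)
  qed (auto simp: coeff_int_def intro: sum.neutral)
  finally show ?thesis .
qed

text \<open>
  A filling with an entry above \<open>N\<close> has a monomial divisible by a variable that is set to 0.
\<close>
lemma truncate_vars_rpp_monomial:
  assumes D: "finite D" and R: "R \<in> rpps D"
  shows "truncate_vars N (rpp_monomial D R) =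
    (if R \<in> bounded_rpps D 0 N then \<Prod>v\<in>{0<..N}. mfps_var v ^ columns_containing D R v else 0)"
proof -
  interpret comm_ring_hom "truncate_vars N :: (nat, int) mfps \<Rightarrow> _"
    by (rule comm_ring_hom_truncate_vars)
  have none: "columns_containing D R v = 0" if "v \<notin> R ` D" for v
  proof -
    have "{j. \<exists>i. (i, j) \<in> D \<and> R (i, j) = v} = {}"
      using that by force
    then show ?thesis
      unfolding columns_containing_def by (simp only: card.empty)
  qed
  have pos: "0 < R p" if "p \<in> D" for p
    using R that by (force simp: rpps_def PiE_def)
  have mono: "rpp_monomial D R = (\<Prod>v\<in>A. mfps_var v ^ columns_containing D R v)"
    if "finite A" "R ` D \<subseteq> A" for A
    unfolding rpp_monomial_def using that none
    by (intro Prod_any.expand_superset) (auto, metis imageI power_0 subsetD)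
  show ?thesis
  proof (cases "R \<in> bounded_rpps D 0 N")
    case True
    then have "R ` D \<subseteq> {0<..N}"
      by (auto simp: bounded_rpps_def)
    then have "truncate_vars N (rpp_monomial D R) =
        (\<Prod>v\<in>{0<..N}. truncate_vars N (mfps_var v) ^ columns_containing D R v)"
      by (subst mono[of "{0<..N}"]) (simp_all add: hom_prod hom_power)
    then show ?thesis
      using True by (simp add: truncate_vars_var)
  next
    case False
    then obtain p where p: "p \<in> D" "N < R p"
      using R pos by (auto simp: bounded_rpps_def not_le)
    have "finite {j. \<exists>i. (i, j) \<in> D \<and> R (i, j) = R p}"
      by (rule finite_subset[of _ "snd ` D"]) (use D in force)+
    moreover have "snd p \<in> {j. \<exists>i. (i, j) \<in> D \<and> R (i, j) = R p}"
      using p by (cases p) auto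
    ultimately have "0 < columns_containing D R (R p)"
      unfolding columns_containing_def by (auto simp: card_gt_0_iff)
    then have "truncate_vars N (mfps_var (R p) ^ columns_containing D R (R p) :: (nat, int) mfps) = 0"
      using p by (simp add: hom_power truncate_vars_var zero_power)
    then have "(\<Prod>v\<in>R ` D. truncate_vars N (mfps_var v ^ columns_containing D R v :: (nat, int) mfps)) = 0"
      using D p by (intro prod_zero) auto
    then show ?thesis
      using False D by (simp add: mono[of "R ` D"] hom_prod)
  qed
qed

lemma truncate_vars_rpp_sum:
  assumes "finite D"
  shows "truncate_vars N (mfps_sum (rpp_monomial D) (rpps D)) = rpp_gf mfps_var 0 N D"
proof -
  have "truncate_vars N (mfps_sum (rpp_monomial D) (rpps D)) =
      (\<Sum>R\<in>bounded_rpps D 0 N. truncate_vars N (rpp_monomial D R))"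
    using assms by (intro truncate_vars_mfps_sum)
      (auto simp: finite_bounded_rpps truncate_vars_rpp_monomial, simp add: bounded_rpps_def)
  also have "\<dots> = rpp_gf mfps_var 0 N D"
    unfolding rpp_gf_def using assms
    by (intro sum.cong) (auto simp: truncate_vars_rpp_monomial bounded_rpps_def)
  finally show ?thesis .
qed

section \<open>Partitions and their columns\<close>

lemma partition_le_iff_diagram_subset: "partition_le m l \<longleftrightarrow> diagram m \<subseteq> diagram l"
proof
  assume le: "partition_le m l"
  show "diagram m \<subseteq> diagram l"
  proof clarify
    fix i j assume "(i, j) \<in> diagram m"
    then have "1 \<le> i" "1 \<le> j" "j \<le> part l i"
      using le by (auto simp: diagram_def partition_le_def intro: order_trans)
    moreover from this have "i \<le> length l"
      by (auto simp: part_def split: if_splits)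
    ultimately show "(i, j) \<in> diagram l"
      by (simp add: diagram_def)
  qed
next
  assume sub: "diagram m \<subseteq> diagram l"
  show "partition_le m l"
    unfolding partition_le_def
  proof
    fix i
    show "part m i \<le> part l i"
    proof (cases "part m i = 0")
      case False
      then have "(i, part m i) \<in> diagram m"
        by (auto simp: diagram_def part_def split: if_splits)
      then have "(i, part m i) \<in> diagram l"
        using sub by blast
      then show ?thesis
        by (simp add: diagram_def)
    qed simp
  qed
qed

lemma diagram_eq_column_shape:
  assumes "is_partition p" and "length (conj_partition p) \<le> n"
  shows "diagram p = column_shape n (\<lambda>c. part (conj_partition p) (Suc c)) (\<lambda>_. 0)"
proof -
  have "(i, j) \<in> diagram p \<longleftrightarrow> (j, i) \<in> diagram (conj_partition p)" for i j
    using diagram_conj_partition[OF assms(1)] by simp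
  also have "(j, i) \<in> diagram (conj_partition p) \<longleftrightarrow>
      (i, j) \<in> column_shape n (\<lambda>c. part (conj_partition p) (Suc c)) (\<lambda>_. 0)" for i j
    using assms(2) by (cases j) (auto simp: diagram_def part_def split: if_splits)
  finally show ?thesis
    by auto
qed

lemma antimono_columns:
  assumes "is_partition p"
  shows "antimono_on {..<n} (\<lambda>c. part (conj_partition p) (Suc c))"
  using part_antimono[OF is_partition_conj_partition[OF assms]] by (auto simp: monotone_on_def)

theorem corollary1p2:
  fixes lam mu :: "nat list" and n :: nat
  assumes "is_partition lam" and "is_partition mu"
    and "length (conj_partition lam) \<le> n"
    and "length (conj_partition mu) \<le> n"
  shows "dual_grothendieck lam mu =
    det (mat n n (\<lambda>(r, c).
      let i = r + 1; j = c + 1;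
          a = int (part (conj_partition lam) i); b = int (part (conj_partition mu) j)
      in Sum_any (\<lambda>k :: nat.
           of_nat (binom (a - b - 1) k) * esym (a - b - int i + int j - int k))))"
proof (rule mfps_eqI_truncate_vars)
  fix N
  interpret comm_ring_hom "truncate_vars N :: (nat, int) mfps \<Rightarrow> _"
    by (rule comm_ring_hom_truncate_vars)
  define a where "a c = part (conj_partition lam) (Suc c)" for c
  define b where "b c = part (conj_partition mu) (Suc c)" for c
  define H :: "(nat, int) mfps fps" where "H = elem_gf mfps_var {0<..N}"
  have a: "antimono_on {..<n} a" and b: "antimono_on {..<n} b"
    unfolding a_def b_def using assms by (auto intro: antimono_columns)
  have diagrams: "diagram lam = column_shape n a (\<lambda>_. 0)" "diagram mu = column_shape n b (\<lambda>_. 0)"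
    unfolding a_def b_def using assms by (simp_all only: diagram_eq_column_shape)
  have skew: "skew_diagram lam mu = column_shape n a b"
    unfolding skew_diagram_def diagrams by (auto simp: column_shape_def)
  have le_iff: "partition_le mu lam \<longleftrightarrow> (\<forall>c<n. b c \<le> a c)"
  proof
    assume "partition_le mu lam"
    then have sub: "column_shape n b (\<lambda>_. 0) \<subseteq> column_shape n a (\<lambda>_. 0)"
      unfolding partition_le_iff_diagram_subset diagrams .
    show "\<forall>c<n. b c \<le> a c"
    proof (intro allI impI)
      fix c assume "c < n"
      then show "b c \<le> a c"
        using subsetD[OF sub, of "(b c, Suc c)"] by (cases "b c = 0") auto
    qed
  next
    assume "\<forall>c<n. b c \<le> a c"
    then show "partition_le mu lam"
      unfolding partition_le_iff_diagram_subset diagrams by (fastforce simp: column_shape_def)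
  qed
  have lhs: "truncate_vars N (dual_grothendieck lam mu) = jt_det n H a b"
  proof (cases "partition_le mu lam")
    case True
    then show ?thesis
      using jt_det_eq_rpp_gf[OF a b, of 0 N "mfps_var :: nat \<Rightarrow> (nat, int) mfps"] le_iff
      by (simp add: dual_grothendieck_def skew H_def truncate_vars_rpp_sum finite_column_shape)
  next
    case False
    then obtain j where "j < n" "a j < b j"
      using le_iff by (auto simp: not_le)
    then show ?thesis
      using False jt_det_not_contained[OF a b] by (simp add: dual_grothendieck_def)
  qed
  let ?entry = "\<lambda>r c. Sum_any (\<lambda>k :: nat. of_nat (binom (int (a r) - int (b c) - 1) k) *
      esym (int (a r) - int (b c) - int (r + 1) + int (c + 1) - int k))"
  have entry: "truncate_vars N (?entry r c) = binom_entry H (a r) r (b c) c" for r c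
  proof -
    have high: "binom (int (a r) - int (b c) - 1) k = 0" if "\<not> k \<le> a r" for k
      using that by (auto simp: binom_def binomial_eq_0)
    have "?entry r c = (\<Sum>k\<le>a r. of_nat (binom (int (a r) - int (b c) - 1) k) *
        esym (int (a r) - int (b c) - int (r + 1) + int (c + 1) - int k))"
    proof (intro Sum_any.expand_superset subsetI)
      fix k assume k: "k \<in> {k. of_nat (binom (int (a r) - int (b c) - 1) k) *
        esym (int (a r) - int (b c) - int (r + 1) + int (c + 1) - int k) \<noteq> 0}"
      show "k \<in> {..a r}"
        using k high[of k] by (cases "k \<le> a r") simp_all
    qed simp
    then show ?thesis
      by (simp add: hom_sum hom_mult hom_of_nat truncate_vars_esym binom_entry_def H_def algebra_simps)
  qed
  have "truncate_vars N (det (mat n n (\<lambda>(r, c). ?entry r c))) =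
      det (map_mat (truncate_vars N) (mat n n (\<lambda>(r, c). ?entry r c)))"
    by simp
  also have "map_mat (truncate_vars N) (mat n n (\<lambda>(r, c). ?entry r c)) =
      mat n n (\<lambda>(r, c). binom_entry H (a r) r (b c) c)"
    by (rule eq_matI) (simp_all only: index_map_mat index_mat dim_row_mat dim_col_mat entry split_conv)
  also have "det \<dots> = jt_det n H a b"
  proof (rule det_binom_entry[OF a b])
    have "{S. S \<subseteq> {0<..N} \<and> card S = 0} = {{}}"
      by (auto dest: finite_subset)
    then show "fps_nth H 0 = 1"
      unfolding H_def by (subst elem_gf_nth) auto
  qed
  finally show "truncate_vars N (dual_grothendieck lam mu) = truncate_vars N (det (mat n n (\<lambda>(r, c).
      let i = r + 1; j = c + 1;
          a = int (part (conj_partition lam) i); b = int (part (conj_partition mu) j)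
      in Sum_any (\<lambda>k :: nat.
           of_nat (binom (a - b - 1) k) * esym (a - b - int i + int j - int k)))))"
    unfolding lhs by (simp add: Let_def a_def b_def)
qed

end
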